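(* Let $d\ge1$, $p_d:=\frac{2d+1}{4d}$, $p\in(p_d,1]$ and $a:=\frac{2dp-1}{2d-1}$. Let $W_d=(W_d(1),\dots,W_d(d))$ be the almost sure limit of the $2d$-type branching process defined in the context, let $w:=\sum_{i=1}^dW_d(i)$, and let $\varphi(x)=f(x)+\mathrm{i}\,g(x)$ ($f,g$ real-valued, $x\in\mathbb{R}$) be the characteristic function of $w$. Then $\varphi$ satisfies $$\varphi(x)+a\,x\,\varphi'(x)=\frac{dp+d-1}{2d-1}\,\varphi^2(x)+\frac{d-dp}{2d-1}\,|\varphi(x)|^2,\qquad x\in\mathbb{R}.$$ In particular, $f$ and $g$ solve $$\begin{cases} f(x)+a x f'(x)=f^2(x)+\frac{1-2dp}{2d-1}\,g^2(x),\\[2pt] g(x)+a x g'(x)=\frac{2(dp+d-1)}{2d-1}\,f(x)g(x),\end{cases}\qquad x\in\mathbb{R},$$ with initial conditions $f(0)=1$ and $g'(0)=1$.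
   Context: Continuous-time urn (branching) process: consider an urn whose balls carry one of the $2d$ directions $e_1,-e_1,\dots,e_d,-e_d$. At time $0$ the urn contains exactly one ball, of direction $e_1$. Each ball present is equipped with an $\mathrm{Exp}(1)$-distributed random clock, all clocks being independent. When the clock of a ball of some direction rings, one adds to the urn a new ball, which has the same direction with probability $p$ and each of the $2d-1$ other directions with probability $\frac{1-p}{2d-1}$; the clock that rang is replaced by a new independent $\mathrm{Exp}(1)$ clock, and the added ball receives its own independent $\mathrm{Exp}(1)$ clock. For $t\ge0$ let $U_t(i)$ and $U_t(-i)$ be the numbers of balls of direction $e_i$ and $-e_i$, respectively, at time $t$. It is known that for $p>p_d$ the limit $$W_d:=\lim_{t\to\infty}\frac{(U_t(i)-U_t(-i))_{1\le i\le d}}{e^{at}}\in\mathbb{R}^d$$ exists almost surely, and that $\mathbb{E}W_d=e_1$. *)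

theory Defs
  imports "HOL-Probability.Probability"
begin

text \<open>The directions \<open>e\<^sub>1, -e\<^sub>1, \<dots>, e\<^sub>d, -e\<^sub>d\<close> are encoded as the nonzero integers
  \<open>1, -1, \<dots>, d, -d\<close>.\<close>

definition directions :: "nat \<Rightarrow> int set" where
  "directions d = {i. i \<noteq> 0 \<and> \<bar>i\<bar> \<le> int d}"

definition critical_p :: "nat \<Rightarrow> real" where
  "critical_p d = (2 * real d + 1) / (4 * real d)"

text \<open>Balls carry Ulam--Harris labels: the initial ball is \<open>[]\<close>, and \<open>k # u\<close> is the ball added
  when the clock of ball \<open>u\<close> rings for the \<open>k\<close>-th time (counting from 0). Here \<open>\<tau> u k\<close> is the
  duration of the \<open>k\<close>-th clock of ball \<open>u\<close>, and \<open>\<delta> u k c\<close> is the direction given to the ball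
  \<open>k # u\<close> when its parent \<open>u\<close> has direction \<open>c\<close>.\<close>

primrec birth_time :: "(nat list \<Rightarrow> nat \<Rightarrow> real) \<Rightarrow> nat list \<Rightarrow> real" where
  "birth_time \<tau> [] = 0"
| "birth_time \<tau> (k # u) = birth_time \<tau> u + (\<Sum>j\<le>k. \<tau> u j)"

primrec direction :: "(nat list \<Rightarrow> nat \<Rightarrow> int \<Rightarrow> int) \<Rightarrow> nat list \<Rightarrow> int" where
  "direction \<delta> [] = 1"
| "direction \<delta> (k # u) = \<delta> u k (direction \<delta> u)"

text \<open>The number of balls of direction \<open>i\<close> at time \<open>t\<close>. In the process below only finitely many
  balls are present at any time, almost surely, so that \<open>card\<close> is a genuine count.\<close>

definition urn_count ::
  "(nat list \<Rightarrow> nat \<Rightarrow> 'a \<Rightarrow> real) \<Rightarrow> (nat list \<Rightarrow> nat \<Rightarrow> int \<Rightarrow> 'a \<Rightarrow> int) \<Rightarrow>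
    real \<Rightarrow> int \<Rightarrow> 'a \<Rightarrow> nat" where
  "urn_count clock choice t i \<omega> =
     card {u. birth_time (\<lambda>u k. clock u k \<omega>) u \<le> t \<and>
              direction (\<lambda>u k c. choice u k c \<omega>) u = i}"

text \<open>The choices are embedded into the reals in \<open>indep\<close> only because \<open>indep_vars\<close> needs a common
  value type; measurability of all the variables is part of \<open>indep_vars\<close>.\<close>

locale direction_urn = prob_space M for M :: "'a measure" +
  fixes d :: nat and p :: real
    and clock :: "nat list \<Rightarrow> nat \<Rightarrow> 'a \<Rightarrow> real"
    and choice :: "nat list \<Rightarrow> nat \<Rightarrow> int \<Rightarrow> 'a \<Rightarrow> int"
  assumes clock_law: "distributed M lborel (clock u k) (exponential_density 1)"
    and choice_law: "c \<in> directions d \<Longrightarrow> c' \<in> directions d \<Longrightarrow>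
      prob {\<omega> \<in> space M. choice u k c \<omega> = c'} = (if c' = c then p else (1 - p) / (2 * real d - 1))"
    and indep: "indep_vars (\<lambda>_. borel)
      (case_sum (\<lambda>(u, k). clock u k) (\<lambda>(u, k, c). \<lambda>\<omega>. real_of_int (choice u k c \<omega>)))
      (UNIV <+> UNIV \<times> UNIV \<times> directions d)"

end

theory Submission
  imports Defs
begin

text \<open>Only the signs of the directions matter for \<open>w\<close>. A ball adds a ball of its own sign with
  probability \<open>q = (dp + d - 1) / (2d - 1)\<close> and one of the opposite sign with probability
  \<open>1 - q\<close>; moreover \<open>a = 2q - 1\<close>, and \<open>p > p\<^sub>d\<close> says that \<open>a > 1/2\<close>. Let \<open>N\<^sub>t\<close> be the number of
  positive minus the number of negative balls at time \<open>t\<close>, let \<open>h\<^sub>y(t) = E exp(i y N\<^sub>t)\<close>, and let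
  \<open>Q(z) = q z\<^sup>2 + (1 - q) |z|\<^sup>2\<close>.

  When the clock of the initial ball rings for the first time, the urn splits into two urns that
  are independent of each other and of this time: the one generated by the initial ball with its
  remaining clocks, and the one generated by the added ball. An urn that starts from a negative ball
  has the law of \<open>-N\<close>, which turns \<open>h\<close> into its conjugate and produces \<open>|h|\<^sup>2\<close>. As the first ring is
  exponential,
  \<open>h\<^sub>y(t) = e\<^sup>-\<^sup>t (e\<^sup>i\<^sup>y + \<integral>\<^sub>0\<^sup>t e\<^sup>s Q(h\<^sub>y(s)) ds)\<close>,
  so \<open>h\<^sub>y\<close> solves \<open>h' = Q(h) - h\<close>.

  This is proved for finite pieces of the tree (\<open>char_net_count\<close>). Splitting at the first ring \<open>n\<close> levels
  deep leaves \<open>2\<^sup>n\<close> possible labels, and the signed count over these labels obeys an exact recursion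
  in \<open>n\<close> (\<open>net_count_Suc\<close>). The pieces exhaust the urn because almost surely only finitely many
  balls are born before any given time: the sum of \<open>E exp(-2 b)\<close> over the birth times \<open>b\<close> of all
  balls is finite (\<open>AE_finite_alive\<close>).

  Almost sure convergence \<open>e\<^sup>-\<^sup>a\<^sup>t N\<^sub>t \<rightarrow> w\<close> gives \<open>h\<^sub>y(t) \<rightarrow> \<phi>(x)\<close> along \<open>y = x e\<^sup>-\<^sup>a\<^sup>t\<close>. Inserting
  \<open>y = x e\<^sup>-\<^sup>a\<^sup>(\<^sup>t\<^sup>+\<^sup>r\<^sup>)\<close> into the integral equation between the times \<open>t\<close> and \<open>t + r\<close>, the limit
  \<open>t \<rightarrow> \<infinity>\<close> yields
  \<open>\<phi>(x) = e\<^sup>-\<^sup>r \<phi>(x e\<^sup>-\<^sup>a\<^sup>r) + \<integral>\<^sub>0\<^sup>r e\<^sup>-\<^sup>s Q(\<phi>(x e\<^sup>-\<^sup>a\<^sup>s)) ds\<close> (\<open>limit_step\<close>),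
  and differentiating in \<open>r\<close> gives the equation at every \<open>x \<noteq> 0\<close>. At \<open>x = 0\<close>, differentiability
  and \<open>\<phi>'(0) = i\<close> come from estimates for the differential equation that survive the rescaling
  (\<open>branching_solution_bounds\<close>), and this is where \<open>a > 1/2\<close> enters. They play the part
  of bounds on the first two moments of \<open>N\<^sub>t\<close>.\<close>

section \<open>The tree of balls, cut at the first ring\<close>

text \<open>After the first ring the initial ball keeps its label, but its \<open>k\<close>-th child is the child number
  \<open>k + 1\<close> of the original tree. The map \<open>delay\<close> turns labels of the restarted tree into original
  labels by raising the last list entry, which is the first generation. The descendants of the
  added ball \<open>[0]\<close> are the labels ending in \<open>0\<close>.\<close>

primrec delay :: "nat list \<Rightarrow> nat list" where
  "delay [] = []"
| "delay (k # u) = (if u = [] then [Suc k] else k # delay u)"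

abbreviation graft :: "nat list \<Rightarrow> nat list" where
  "graft u \<equiv> u @ [0]"

definition delayed :: "(nat list \<Rightarrow> nat \<Rightarrow> 'b) \<Rightarrow> nat list \<Rightarrow> nat \<Rightarrow> 'b" where
  "delayed f u k = (if u = [] then f [] (Suc k) else f (delay u) k)"

definition grafted :: "(nat list \<Rightarrow> nat \<Rightarrow> 'b) \<Rightarrow> nat list \<Rightarrow> nat \<Rightarrow> 'b" where
  "grafted f u k = f (graft u) k"

text \<open>The urn that starts from a ball of direction \<open>c\<close> is needed as well, since the ball added at the
  first ring may have any direction.\<close>

primrec direction_from :: "(nat list \<Rightarrow> nat \<Rightarrow> int \<Rightarrow> int) \<Rightarrow> int \<Rightarrow> nat list \<Rightarrow> int" where
  "direction_from \<delta> c [] = c"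
| "direction_from \<delta> c (k # u) = \<delta> u k (direction_from \<delta> c u)"

text \<open>The labels reached by splitting the urn at its first ring and then splitting both parts in the same
  way, \<open>n\<close> levels deep. There are \<open>2\<^sup>n\<close> of them, so that the counts below are finite sums.\<close>

primrec labels :: "nat \<Rightarrow> nat list set" where
  "labels 0 = {[]}"
| "labels (Suc n) = delay ` labels n \<union> graft ` labels n"

lemma delay_snoc [simp]: "delay (u @ [k]) = u @ [Suc k]"
  by (induction u) auto

lemma delay_eq_Nil_iff [simp]: "delay u = [] \<longleftrightarrow> u = []"
  by (cases u) auto

lemma delay_neq_graft [simp]: "delay u \<noteq> graft v" "graft v \<noteq> delay u"
  by (cases u rule: rev_cases; simp)+

lemma inj_delay: "inj delay"
proof (rule injI)
  fix u v assume "delay u = delay v"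
  then show "u = v"
    by (cases u rule: rev_cases; cases v rule: rev_cases) auto
qed

lemma inj_graft: "inj graft"
  by (rule injI) simp

lemma finite_labels [simp]: "finite (labels n)"
  by (induction n) auto

lemma Nil_in_labels [simp]: "[] \<in> labels n"
proof (induction n)
  case (Suc n)
  then have "delay [] \<in> delay ` labels n" by blast
  then show ?case by simp
qed simp

lemma labels_Suc_mono: "labels n \<subseteq> labels (Suc n)"
proof (induction n)
  case (Suc n)
  then show ?case by (simp only: labels.simps) blast
qed simp

lemma labels_mono: "m \<le> n \<Longrightarrow> labels m \<subseteq> labels n"
  using labels_Suc_mono by (rule lift_Suc_mono_le)

text \<open>Undoing a delay lowers the last entry of a label, and undoing a graft removes it once it is \<open>0\<close>;
  so every label reduces to the root in finitely many steps.\<close>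

lemma labels_exhaust: "\<exists>n. u \<in> labels n"
proof (induction u rule: rev_induct)
  case Nil
  show ?case by (rule exI[of _ 0]) simp
next
  case (snoc k u)
  then obtain m where m: "u \<in> labels m" by blast
  show ?case
  proof (induction k)
    case 0
    have "u @ [0] \<in> labels (Suc m)" using m by simp
    then show ?case by blast
  next
    case (Suc k)
    then obtain n where n: "u @ [k] \<in> labels n" by blast
    then have "delay (u @ [k]) \<in> labels (Suc n)" by (simp only: labels.simps) blast
    then have "u @ [Suc k] \<in> labels (Suc n)" by (simp only: delay_snoc)
    then show ?case by blast
  qed
qed

lemma finite_subset_labels:
  assumes "finite F"
  shows "\<exists>n. F \<subseteq> labels n"
  using assms
proof (induction F)
  case (insert u F)
  then obtain m n where "F \<subseteq> labels m" "u \<in> labels n" using labels_exhaust by blast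
  then have "insert u F \<subseteq> labels (max m n)"
    using labels_mono[of m "max m n"] labels_mono[of n "max m n"] by auto
  then show ?case by blast
qed simp

lemma sum_labels_Suc:
  fixes F :: "nat list \<Rightarrow> 'b::comm_monoid_add"
  shows "(\<Sum>u\<in>labels (Suc n). F u) = (\<Sum>u\<in>labels n. F (delay u)) + (\<Sum>u\<in>labels n. F (graft u))"
proof -
  have "(\<Sum>u\<in>labels (Suc n). F u)
      = (\<Sum>u\<in>delay ` labels n. F u) + (\<Sum>u\<in>graft ` labels n. F u)"
    by (simp only: labels.simps, intro sum.union_disjoint) auto
  also have "(\<Sum>u\<in>delay ` labels n. F u) = (\<Sum>u\<in>labels n. F (delay u))"
    using inj_delay by (subst sum.reindex) (auto intro: inj_on_subset)
  also have "(\<Sum>u\<in>graft ` labels n. F u) = (\<Sum>u\<in>labels n. F (graft u))"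
    using inj_graft by (subst sum.reindex) (auto intro: inj_on_subset)
  finally show ?thesis .
qed

lemma birth_time_delay:
  "u \<noteq> [] \<Longrightarrow> birth_time \<tau> (delay u) = \<tau> [] 0 + birth_time (delayed \<tau>) u"
proof (induction u)
  case (Cons k u)
  show ?case
  proof (cases "u = []")
    case True
    then show ?thesis using sum.atMost_Suc_shift[of "\<tau> []" k] by (simp add: delayed_def)
  next
    case False
    then show ?thesis using Cons.IH by (simp add: delayed_def)
  qed
qed simp

lemma birth_time_graft: "birth_time \<tau> (graft u) = \<tau> [] 0 + birth_time (grafted \<tau>) u"
  by (induction u) (simp_all add: grafted_def)

lemma direction_from_delay: "direction_from \<delta> c (delay u) = direction_from (delayed \<delta>) c u"
  by (induction u) (simp_all add: delayed_def)

lemma direction_from_graft: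
  "direction_from \<delta> c (graft u) = direction_from (grafted \<delta>) (\<delta> [] 0 c) u"
  by (induction u) (simp_all add: grafted_def)

lemma birth_time_nonneg: "(\<And>u k. 0 \<le> \<tau> u k) \<Longrightarrow> 0 \<le> birth_time \<tau> u"
  by (induction u) (auto intro!: add_nonneg_nonneg sum_nonneg)

definition signed_count ::
  "nat \<Rightarrow> int \<Rightarrow> real \<Rightarrow> (nat list \<Rightarrow> nat \<Rightarrow> real) \<Rightarrow> (nat list \<Rightarrow> nat \<Rightarrow> int \<Rightarrow> int) \<Rightarrow> real" where
  "signed_count n c t \<tau> \<delta> =
     (\<Sum>u\<in>labels n. if birth_time \<tau> u \<le> t then of_int (sgn (direction_from \<delta> c u)) else 0)"

lemma signed_count_0: "0 \<le> t \<Longrightarrow> signed_count 0 c t \<tau> \<delta> = of_int (sgn c)"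
  by (simp add: signed_count_def)

text \<open>Every label except the root is a graft or the delay of a label other than the root, hence born no
  earlier than the first ring.\<close>

lemma signed_count_before_first_ring:
  assumes "\<And>u k. 0 \<le> \<tau> u k" "0 \<le> t" "t < \<tau> [] 0"
  shows "signed_count n c t \<tau> \<delta> = of_int (sgn c)"
proof -
  have late: "t < birth_time \<tau> u" if "u \<noteq> []" for u
  proof (cases "u" rule: rev_cases)
    case (snoc v k)
    have "(\<exists>v'. u = delay v' \<and> v' \<noteq> []) \<or> (\<exists>v'. u = graft v')"
    proof (cases k)
      case 0 then show ?thesis using snoc by auto
    next
      case (Suc j)
      then have "u = delay (v @ [j])" using snoc by simp
      then show ?thesis by (metis snoc_eq_iff_butlast)
    qed
    then show ?thesis
    proof (elim disjE exE conjE)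
      fix v' assume "u = delay v'" "v' \<noteq> []"
      moreover have "0 \<le> birth_time (delayed \<tau>) v'"
        using assms(1) by (intro birth_time_nonneg) (simp add: delayed_def)
      ultimately show ?thesis using birth_time_delay[of v' \<tau>] assms(3) by simp
    next
      fix v' assume "u = graft v'"
      moreover have "0 \<le> birth_time (grafted \<tau>) v'"
        using assms(1) by (intro birth_time_nonneg) (simp add: grafted_def)
      ultimately show ?thesis using birth_time_graft[of \<tau> v'] assms(3) by simp
    qed
  qed (use that in simp)
  have "signed_count n c t \<tau> \<delta> = (\<Sum>u\<in>labels n. if u = [] then of_int (sgn c) else 0)"
    unfolding signed_count_def
    using assms(2) late by (intro sum.cong refl) (auto dest: leD)
  then show ?thesis by (simp add: sum.delta)
qed

lemma signed_count_after_first_ring: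
  assumes "\<tau> [] 0 \<le> t" "0 \<le> \<tau> [] 0"
  shows "signed_count (Suc n) c t \<tau> \<delta> =
    signed_count n c (t - \<tau> [] 0) (delayed \<tau>) (delayed \<delta>)
    + signed_count n (\<delta> [] 0 c) (t - \<tau> [] 0) (grafted \<tau>) (grafted \<delta>)"
proof -
  have "birth_time \<tau> (delay u) \<le> t \<longleftrightarrow> birth_time (delayed \<tau>) u \<le> t - \<tau> [] 0" for u
    using assms birth_time_delay[of u \<tau>] by (cases "u = []") auto
  moreover have "birth_time \<tau> (graft u) \<le> t \<longleftrightarrow> birth_time (grafted \<tau>) u \<le> t - \<tau> [] 0" for u
    using birth_time_graft[of \<tau> u] by auto
  ultimately show ?thesis
    unfolding signed_count_def sum_labels_Suc by (simp only: direction_from_delay direction_from_graft)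
qed

section \<open>Independence of the two parts of the urn\<close>

text \<open>A clock \<open>(u, k)\<close> and a choice \<open>(u, k, c)\<close> are coordinates of one real-valued path. Clocks are read
  through the absolute value, and impossible choices as direction \<open>1\<close>; both differ from the urn only on
  a null set. In exchange the splitting at the first ring holds for every path, and a path is read at
  the coordinates of the independent family only.\<close>

type_synonym coordinate = "(nat list \<times> nat) + (nat list \<times> nat \<times> int)"

definition coordinates :: "nat \<Rightarrow> coordinate set" where
  "coordinates d = UNIV <+> UNIV \<times> UNIV \<times> directions d"

definition clock_of :: "(coordinate \<Rightarrow> real) \<Rightarrow> nat list \<Rightarrow> nat \<Rightarrow> real" where
  "clock_of x u k = \<bar>x (Inl (u, k))\<bar>"

definition choice_of :: "nat \<Rightarrow> (coordinate \<Rightarrow> real) \<Rightarrow> nat list \<Rightarrow> nat \<Rightarrow> int \<Rightarrow> int" where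
  "choice_of d x u k c =
     (if c \<in> directions d \<and> \<lfloor>x (Inr (u, k, c))\<rfloor> \<in> directions d then \<lfloor>x (Inr (u, k, c))\<rfloor> else 1)"

definition net_count :: "nat \<Rightarrow> nat \<Rightarrow> int \<Rightarrow> real \<Rightarrow> (coordinate \<Rightarrow> real) \<Rightarrow> real" where
  "net_count d n c t x = signed_count n c t (clock_of x) (choice_of d x)"

text \<open>The embeddings of labels carry clocks and choices along. The root keeps its label under \<open>delay\<close>, so
  there the ring number is raised instead.\<close>

fun delay_coord :: "coordinate \<Rightarrow> coordinate" where
  "delay_coord (Inl (u, k)) = Inl (delay u, if u = [] then Suc k else k)"
| "delay_coord (Inr (u, k, c)) = Inr (delay u, if u = [] then Suc k else k, c)"

fun graft_coord :: "coordinate \<Rightarrow> coordinate" where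
  "graft_coord (Inl (u, k)) = Inl (graft u, k)"
| "graft_coord (Inr (u, k, c)) = Inr (graft u, k, c)"

lemma Inl_in_coordinates [simp]: "Inl r \<in> coordinates d"
  by (auto simp: coordinates_def)

lemma Inr_in_coordinates [simp]: "Inr (u, k, c) \<in> coordinates d \<longleftrightarrow> c \<in> directions d"
  by (auto simp: coordinates_def)

lemma delay_coord_in [simp]: "delay_coord i \<in> coordinates d \<longleftrightarrow> i \<in> coordinates d"
  by (cases i rule: delay_coord.cases) simp_all

lemma graft_coord_in [simp]: "graft_coord i \<in> coordinates d \<longleftrightarrow> i \<in> coordinates d"
  by (cases i rule: graft_coord.cases) simp_all

lemma inj_delay_coord: "inj delay_coord"
proof (rule injI)
  fix i j assume "delay_coord i = delay_coord j"
  then show "i = j"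
    by (cases i rule: delay_coord.cases; cases j rule: delay_coord.cases)
       (auto simp: inj_eq[OF inj_delay] split: if_splits)
qed

lemma inj_graft_coord: "inj graft_coord"
proof (rule injI)
  fix i j assume "graft_coord i = graft_coord j"
  then show "i = j"
    by (cases i rule: graft_coord.cases; cases j rule: graft_coord.cases) auto
qed

lemma delay_coord_neq_graft_coord [simp]: "delay_coord i \<noteq> graft_coord j"
  by (cases i rule: delay_coord.cases; cases j rule: graft_coord.cases) auto

lemma delay_coord_neq_first [simp]:
  "delay_coord i \<noteq> Inl ([], 0)" "delay_coord i \<noteq> Inr ([], 0, c)"
  by (cases i rule: delay_coord.cases; simp)+

lemma graft_coord_neq_first [simp]:
  "graft_coord i \<noteq> Inl ([], 0)" "graft_coord i \<noteq> Inr ([], 0, c)"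
  by (cases i rule: graft_coord.cases; simp)+

lemma clock_of_delay: "clock_of (\<lambda>i. x (delay_coord i)) = delayed (clock_of x)"
  by (auto simp: fun_eq_iff clock_of_def delayed_def)

lemma clock_of_graft: "clock_of (\<lambda>i. x (graft_coord i)) = grafted (clock_of x)"
  by (auto simp: fun_eq_iff clock_of_def grafted_def)

lemma choice_of_delay: "choice_of d (\<lambda>i. x (delay_coord i)) = delayed (choice_of d x)"
  by (auto simp: fun_eq_iff choice_of_def delayed_def)

lemma choice_of_graft: "choice_of d (\<lambda>i. x (graft_coord i)) = grafted (choice_of d x)"
  by (auto simp: fun_eq_iff choice_of_def grafted_def)

lemma finite_directions [simp]: "finite (directions d)"
  by (rule finite_subset[of _ "{- int d..int d}"]) (auto simp: directions_def)

lemma one_in_directions [simp]: "1 \<le> d \<Longrightarrow> 1 \<in> directions d"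
  by (simp add: directions_def)

lemma choice_of_in [simp]: "1 \<le> d \<Longrightarrow> choice_of d x u k c \<in> directions d"
  by (simp add: choice_of_def)

lemma net_count_cong:
  assumes "\<And>i. i \<in> coordinates d \<Longrightarrow> x i = y i"
  shows "net_count d n c t x = net_count d n c t y"
proof -
  have "clock_of x = clock_of y" using assms by (auto simp: fun_eq_iff clock_of_def)
  moreover have "choice_of d x = choice_of d y"
    using assms by (auto simp: fun_eq_iff choice_of_def)
  ultimately show ?thesis by (simp add: net_count_def)
qed

lemma net_count_0: "0 \<le> t \<Longrightarrow> net_count d 0 c t x = of_int (sgn c)"
  by (simp add: net_count_def signed_count_0)

lemma net_count_Suc:
  assumes "0 \<le> t"
  shows "net_count d (Suc n) c t x = (if t < \<bar>x (Inl ([], 0))\<bar> then of_int (sgn c)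
    else net_count d n c (t - \<bar>x (Inl ([], 0))\<bar>) (\<lambda>i. x (delay_coord i))
       + net_count d n (choice_of d x [] 0 c) (t - \<bar>x (Inl ([], 0))\<bar>) (\<lambda>i. x (graft_coord i)))"
  using signed_count_before_first_ring[of "clock_of x" t "Suc n" c "choice_of d x"]
    signed_count_after_first_ring[of "clock_of x" t n c "choice_of d x"] assms
  unfolding net_count_def clock_of_delay clock_of_graft choice_of_delay choice_of_graft
  by (auto simp: clock_of_def)

lemma measurable_choice_of:
  assumes "\<And>i. (\<lambda>\<omega>. x \<omega> i) \<in> borel_measurable N"
  shows "(\<lambda>\<omega>. choice_of d (x \<omega>) u k c) \<in> measurable N (count_space UNIV)"
proof -
  have [measurable]: "(\<lambda>\<omega>. x \<omega> (Inr (u, k, c))) \<in> borel_measurable N" by (rule assms)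
  show ?thesis unfolding choice_of_def by measurable
qed

lemma measurable_birth_time:
  assumes x: "\<And>i. (\<lambda>\<omega>. x \<omega> i) \<in> borel_measurable N"
  shows "(\<lambda>\<omega>. birth_time (clock_of (x \<omega>)) u) \<in> borel_measurable N"
  by (induction u) (auto simp: clock_of_def intro!: borel_measurable_add borel_measurable_sum
      borel_measurable_abs x)

text \<open>Stated for an arbitrary measurable space, so that it covers random variables as well as paths
  restricted to a set of coordinates, possibly together with a variable time.\<close>

lemma measurable_net_count:
  assumes x: "\<And>i. (\<lambda>\<omega>. x \<omega> i) \<in> borel_measurable N" and t: "t \<in> borel_measurable N"
  shows "(\<lambda>\<omega>. net_count d n c (t \<omega>) (x \<omega>)) \<in> borel_measurable N"
proof -
  have dir: "(\<lambda>\<omega>. direction_from (choice_of d (x \<omega>)) c u) \<in> measurable N (count_space UNIV)" for u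
  proof (induction u)
    case (Cons k u)
    show ?case
      unfolding direction_from.simps
      by (rule measurable_compose_countable[OF measurable_choice_of[OF x] Cons.IH])
  qed simp
  note [measurable] = measurable_birth_time[OF x] dir t
  show ?thesis unfolding net_count_def signed_count_def by measurable
qed

context prob_space
begin

lemma indep_vars_reindex:
  assumes "indep_vars N X I" and inj: "inj_on f J" and sub: "f ` J \<subseteq> I"
  shows "indep_vars (\<lambda>j. N (f j)) (\<lambda>j. X (f j)) J"
  unfolding indep_vars_def2
proof (intro conjI ballI)
  show "X (f j) \<in> measurable M (N (f j))" if "j \<in> J" for j
    using assms that by (auto simp: indep_vars_def2)
  have ind: "indep_sets (\<lambda>i. {X i -` A \<inter> space M |A. A \<in> sets (N i)}) I"
    using assms(1) by (simp add: indep_vars_def2)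
  show "indep_sets (\<lambda>j. {X (f j) -` A \<inter> space M |A. A \<in> sets (N (f j))}) J"
  proof (rule indep_setsI)
    show "{X (f j) -` A \<inter> space M |A. A \<in> sets (N (f j))} \<subseteq> events" if "j \<in> J" for j
      using ind sub that unfolding indep_sets_def by blast
  next
    fix A K assume K: "K \<noteq> {}" "K \<subseteq> J" "finite K"
      and A: "\<forall>j\<in>K. A j \<in> {X (f j) -` A \<inter> space M |A. A \<in> sets (N (f j))}"
    have inv: "the_inv_into J f (f j) = j" if "j \<in> K" for j
      using inj K that by (auto intro: the_inv_into_f_f)
    have injK: "inj_on f K" using inj K by (blast intro: inj_on_subset)
    have fK: "f ` K \<subseteq> I" using sub K by blast
    have "prob (\<Inter>i\<in>f ` K. A (the_inv_into J f i)) = (\<Prod>i\<in>f ` K. prob (A (the_inv_into J f i)))"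
      using K A fK inv by (intro indep_setsD[OF ind]) auto
    then show "prob (\<Inter>j\<in>K. A j) = (\<Prod>j\<in>K. prob (A j))"
      using inv by (simp add: prod.reindex[OF injK] image_image cong: INF_cong prod.cong)
  qed
qed

text \<open>Conditioning on \<open>T\<close>: the law of an independent pair is a product measure, so this is Fubini's theorem.\<close>

lemma expectation_indep_pair:
  fixes \<Phi> :: "_ \<Rightarrow> _ :: {banach, second_countable_topology}"
  assumes ind: "indep_var S T N Y" and \<Phi>: "\<Phi> \<in> borel_measurable (S \<Otimes>\<^sub>M N)"
    and bound: "\<And>z. norm (\<Phi> z) \<le> B"
  shows "(\<integral>\<omega>. \<Phi> (T \<omega>, Y \<omega>) \<partial>M) = (\<integral>s. (\<integral>\<omega>. \<Phi> (s, Y \<omega>) \<partial>M) \<partial>distr M S T)"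
proof -
  have T: "T \<in> measurable M S" and Y: "Y \<in> measurable M N"
    and eq: "distr M S T \<Otimes>\<^sub>M distr M N Y = distr M (S \<Otimes>\<^sub>M N) (\<lambda>\<omega>. (T \<omega>, Y \<omega>))"
    using ind unfolding indep_var_distribution_eq by auto
  interpret T: prob_space "distr M S T" by (rule prob_space_distr[OF T])
  interpret Y: prob_space "distr M N Y" by (rule prob_space_distr[OF Y])
  interpret pair_prob_space "distr M S T" "distr M N Y" ..
  have m: "\<Phi> \<in> borel_measurable (distr M S T \<Otimes>\<^sub>M distr M N Y)"
    using \<Phi> by (simp cong: measurable_cong_sets)
  have i: "integrable (distr M S T \<Otimes>\<^sub>M distr M N Y) \<Phi>"
    by (rule integrable_const_bound[where B = B, OF _ m]) (auto simp: bound)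
  have "(\<integral>\<omega>. \<Phi> (T \<omega>, Y \<omega>) \<partial>M) = (\<integral>z. \<Phi> z \<partial>(distr M S T \<Otimes>\<^sub>M distr M N Y))"
    unfolding eq using T Y \<Phi> by (subst integral_distr) (auto intro: measurable_Pair)
  also have "\<dots> = (\<integral>s. (\<integral>y. \<Phi> (s, y) \<partial>distr M N Y) \<partial>distr M S T)"
    using integral_fst'[OF i] by simp
  also have "\<dots> = (\<integral>s. (\<integral>\<omega>. \<Phi> (s, Y \<omega>) \<partial>M) \<partial>distr M S T)"
  proof (rule Bochner_Integration.integral_cong[OF refl])
    fix s assume "s \<in> space (distr M S T)"
    then have "(\<lambda>y. \<Phi> (s, y)) \<in> borel_measurable N"
      by (intro measurable_compose[OF measurable_Pair1' \<Phi>]) simp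
    then show "(\<integral>y. \<Phi> (s, y) \<partial>distr M N Y) = (\<integral>\<omega>. \<Phi> (s, Y \<omega>) \<partial>M)"
      by (rule integral_distr[OF Y])
  qed
  finally show ?thesis .
qed

text \<open>All families of random variables with the joint law of the urn. The recursion has to be proved for all
  of them at once, because the two parts of the urn after the first ring are given by other families on the
  same probability space.\<close>

definition urn_family :: "nat \<Rightarrow> real \<Rightarrow> (coordinate \<Rightarrow> 'a \<Rightarrow> real) \<Rightarrow> bool" where
  "urn_family d p X \<longleftrightarrow>
     (\<forall>i. X i \<in> borel_measurable M) \<and> indep_vars (\<lambda>_. borel) X (coordinates d) \<and>
     (\<forall>u k. distributed M lborel (X (Inl (u, k))) (exponential_density 1)) \<and>
     (\<forall>u k. \<forall>c\<in>directions d. \<forall>c'\<in>directions d. prob {\<omega> \<in> space M. \<lfloor>X (Inr (u, k, c)) \<omega>\<rfloor> = c'}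
        = (if c' = c then p else (1 - p) / (2 * real d - 1)))"

lemma urn_familyD:
  assumes "urn_family d p X"
  shows "indep_vars (\<lambda>_. borel) X (coordinates d)"
    and "distributed M lborel (X (Inl (u, k))) (exponential_density 1)"
    and "c \<in> directions d \<Longrightarrow> c' \<in> directions d \<Longrightarrow> prob {\<omega> \<in> space M. \<lfloor>X (Inr (u, k, c)) \<omega>\<rfloor> = c'}
        = (if c' = c then p else (1 - p) / (2 * real d - 1))"
    and "X i \<in> borel_measurable M"
proof -
  show "indep_vars (\<lambda>_. borel) X (coordinates d)"
    by (rule assms[unfolded urn_family_def, THEN conjunct2, THEN conjunct1])
  show "distributed M lborel (X (Inl (u, k))) (exponential_density 1)"
    by (rule assms[unfolded urn_family_def, THEN conjunct2, THEN conjunct2, THEN conjunct1, rule_format])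
  show "c \<in> directions d \<Longrightarrow> c' \<in> directions d \<Longrightarrow> prob {\<omega> \<in> space M. \<lfloor>X (Inr (u, k, c)) \<omega>\<rfloor> = c'}
        = (if c' = c then p else (1 - p) / (2 * real d - 1))"
    by (rule assms[unfolded urn_family_def, THEN conjunct2, THEN conjunct2, THEN conjunct2, rule_format])
  show "X i \<in> borel_measurable M"
    by (rule assms[unfolded urn_family_def, THEN conjunct1, rule_format])
qed

lemma urn_family_delay:
  assumes "urn_family d p X"
  shows "urn_family d p (\<lambda>i. X (delay_coord i))"
  unfolding urn_family_def delay_coord.simps
proof (intro conjI allI ballI)
  show "indep_vars (\<lambda>_. borel) (\<lambda>i. X (delay_coord i)) (coordinates d)"
    using urn_familyD(1)[OF assms] inj_on_subset[OF inj_delay_coord]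
    by (rule indep_vars_reindex) auto
qed (rule urn_familyD(2,3,4)[OF assms]; assumption?)+

lemma urn_family_graft:
  assumes "urn_family d p X"
  shows "urn_family d p (\<lambda>i. X (graft_coord i))"
  unfolding urn_family_def graft_coord.simps
proof (intro conjI allI ballI)
  show "indep_vars (\<lambda>_. borel) (\<lambda>i. X (graft_coord i)) (coordinates d)"
    using urn_familyD(1)[OF assms] inj_on_subset[OF inj_graft_coord]
    by (rule indep_vars_reindex) auto
qed (rule urn_familyD(2,3,4)[OF assms]; assumption?)+

end

section \<open>The differential equation and its scaling limit\<close>

text \<open>The quadratic part of the equation: the two urns after the first ring contribute \<open>z z\<close> if they start
  from balls of equal sign, and \<open>z\<close> times its conjugate otherwise.\<close>

definition branching :: "real \<Rightarrow> complex \<Rightarrow> complex" where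
  "branching q z = of_real q * z^2 + of_real (1 - q) * of_real ((cmod z)^2)"

lemma branching_eq: "branching q z = z * (of_real q * z + of_real (1 - q) * cnj z)"
  unfolding branching_def complex_norm_square by (simp add: power2_eq_square algebra_simps)

lemma Re_branching: "Re (branching q z) = (Re z)^2 + (1 - 2 * q) * (Im z)^2"
  unfolding branching_def by (simp add: cmod_power2 Re_power2 algebra_simps)

lemma Im_branching: "Im (branching q z) = 2 * q * Re z * Im z"
  unfolding branching_def by (simp add: Im_power2)

lemma norm_branching_le_1:
  assumes "0 \<le> q" "q \<le> 1" "cmod z \<le> 1"
  shows "cmod (branching q z) \<le> 1"
proof -
  have z: "(cmod z)^2 \<le> 1" using assms(3) by (simp add: power_le_one)
  have "cmod (branching q z) \<le> q * (cmod z)^2 + (1 - q) * (cmod z)^2"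
    unfolding branching_def using assms
    by (intro norm_triangle_le) (simp add: norm_mult norm_power del: of_real_diff)
  then show ?thesis using z by (simp add: algebra_simps)
qed

lemma continuous_on_branching [continuous_intros]:
  "continuous_on S f \<Longrightarrow> continuous_on S (\<lambda>x. branching q (f x))"
  unfolding branching_def by (intro continuous_intros)

lemma tendsto_branching [tendsto_intros]:
  "(f \<longlongrightarrow> z) F \<Longrightarrow> ((\<lambda>x. branching q (f x)) \<longlongrightarrow> branching q z) F"
  unfolding branching_def by (intro tendsto_intros)

text \<open>The integrated form of \<open>h' = branching q h - h\<close> with \<open>h 0 = z\<close>. It does not presuppose that \<open>h\<close> is
  continuous, and therefore passes to pointwise limits.\<close>

definition branching_solution :: "real \<Rightarrow> complex \<Rightarrow> (real \<Rightarrow> complex) \<Rightarrow> bool" where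
  "branching_solution q z h \<longleftrightarrow>
     (\<forall>t\<ge>0. cmod (h t) \<le> 1) \<and>
     (\<forall>t\<ge>0. (\<lambda>s. exp s *\<^sub>R branching q (h s)) integrable_on {0..t} \<and>
        h t = exp (- t) *\<^sub>R (z + integral {0..t} (\<lambda>s. exp s *\<^sub>R branching q (h s))))"

lemma branching_solutionD:
  assumes "branching_solution q z h" "0 \<le> t"
  shows "cmod (h t) \<le> 1"
    and "(\<lambda>s. exp s *\<^sub>R branching q (h s)) integrable_on {0..t}"
    and "h t = exp (- t) *\<^sub>R (z + integral {0..t} (\<lambda>s. exp s *\<^sub>R branching q (h s)))"
  using assms unfolding branching_solution_def by blast+

lemma branching_solution_0:
  assumes "branching_solution q z h"
  shows "h 0 = z"
  using branching_solutionD(3)[OF assms, of 0] by simp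

lemma branching_solution_continuous_on:
  assumes "branching_solution q z h"
  shows "continuous_on {0..T} h"
proof (cases "0 \<le> T")
  case True
  have "continuous_on {0..T} (\<lambda>t. exp (- t) *\<^sub>R (z + integral {0..t} (\<lambda>s. exp s *\<^sub>R branching q (h s))))"
    using branching_solutionD(2)[OF assms True]
    by (intro continuous_intros indefinite_integral_continuous_1)
  then show ?thesis
    by (rule continuous_on_eq) (use branching_solutionD(3)[OF assms] in simp)
qed simp

lemma branching_solution_has_vector_derivative:
  assumes "branching_solution q z h" "t \<in> {0..T}"
  shows "(h has_vector_derivative (branching q (h t) - h t)) (at t within {0..T})"
proof -
  have c: "continuous_on {0..T} (\<lambda>s. exp s *\<^sub>R branching q (h s))"
    by (intro continuous_intros branching_solution_continuous_on[OF assms(1)])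
  let ?I = "\<lambda>t. integral {0..t} (\<lambda>s. exp s *\<^sub>R branching q (h s))"
  have h: "h s = exp (- s) *\<^sub>R (z + ?I s)" if "s \<in> {0..T}" for s
    using branching_solutionD(3)[OF assms(1), of s] that by simp
  have "((\<lambda>t. exp (- t) *\<^sub>R (z + ?I t)) has_vector_derivative
      (exp (- t) *\<^sub>R (exp t *\<^sub>R branching q (h t)) + (- exp (- t)) *\<^sub>R (z + ?I t))) (at t within {0..T})"
  proof (rule has_vector_derivative_scaleR)
    show "((\<lambda>t. exp (- t)) has_field_derivative - exp (- t)) (at t within {0..T})"
      by (auto intro!: derivative_eq_intros)
    show "((\<lambda>t. z + ?I t) has_vector_derivative exp t *\<^sub>R branching q (h t)) (at t within {0..T})"
      using has_vector_derivative_add[OF has_vector_derivative_const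
          integral_has_vector_derivative[OF c assms(2)]] by simp
  qed
  also have "exp (- t) *\<^sub>R (exp t *\<^sub>R branching q (h t)) + (- exp (- t)) *\<^sub>R (z + ?I t)
      = branching q (h t) - h t"
    using h[OF assms(2)] by (simp add: exp_minus_inverse scaleR_scaleR flip: exp_add)
  finally show ?thesis
    by (rule has_vector_derivative_transform[OF assms(2), rotated]) (rule h)
qed

text \<open>Variation of constants between the times \<open>t\<close> and \<open>t + r\<close>, with the time \<open>s\<close> counted backwards from
  \<open>t + r\<close>. Running backwards matches the scaling: \<open>x e\<^sup>-\<^sup>a\<^sup>(\<^sup>t\<^sup>+\<^sup>r\<^sup>)\<close> is \<open>x e\<^sup>-\<^sup>a\<^sup>s\<close> rescaled by the factor
  belonging to time \<open>t + r - s\<close>.\<close>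

lemma branching_solution_step:
  assumes h: "branching_solution q z h" and "0 \<le> t" "0 \<le> r"
  shows "((\<lambda>s. exp (- s) *\<^sub>R branching q (h (t + r - s))) has_integral
    (h (t + r) - exp (- r) *\<^sub>R h t)) {0..r}"
proof -
  let ?F = "\<lambda>s. - (exp (- s) *\<^sub>R h (t + r - s))"
  have "((\<lambda>s. exp (- s) *\<^sub>R branching q (h (t + r - s))) has_integral (?F r - ?F 0)) {0..r}"
  proof (rule fundamental_theorem_of_calculus[OF \<open>0 \<le> r\<close>])
    fix s assume s: "s \<in> {0..r}"
    let ?u = "t + r - s"
    have sub: "(\<lambda>s. t + r - s) ` {0..r} \<subseteq> {0..t + r}" using assms by auto
    have "(h has_vector_derivative (branching q (h ?u) - h ?u)) (at ?u within {0..t + r})"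
      using s assms by (intro branching_solution_has_vector_derivative[OF h]) auto
    then have "(h has_vector_derivative (branching q (h ?u) - h ?u))
        (at ?u within (\<lambda>s. t + r - s) ` {0..r})"
      using sub by (rule has_vector_derivative_within_subset)
    moreover have "((\<lambda>s. t + r - s) has_vector_derivative -1) (at s within {0..r})"
      by (auto intro!: derivative_eq_intros)
    ultimately have d: "((\<lambda>s. h (t + r - s)) has_vector_derivative (-1) *\<^sub>R (branching q (h ?u) - h ?u))
        (at s within {0..r})"
      using vector_diff_chain_within[of "\<lambda>s. t + r - s" "-1" s "{0..r}" h] unfolding o_def by blast
    have "((\<lambda>s. exp (- s)) has_field_derivative - exp (- s)) (at s within {0..r})"
      by (auto intro!: derivative_eq_intros)
    from has_vector_derivative_minus[OF has_vector_derivative_scaleR[OF this d]]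
    show "(?F has_vector_derivative exp (- s) *\<^sub>R branching q (h ?u)) (at s within {0..r})"
      by (simp add: algebra_simps)
  qed
  then show ?thesis by simp
qed

text \<open>For fixed \<open>s\<close> the initial parameter \<open>x e\<^sup>-\<^sup>a\<^sup>(\<^sup>t\<^sup>+\<^sup>r\<^sup>)\<close> makes \<open>h\<close> at time \<open>t + r - s\<close> converge to \<open>\<phi>\<close> at
  \<open>x e\<^sup>-\<^sup>a\<^sup>s\<close>; everything is bounded by \<open>1\<close>, so dominated convergence applies along \<open>t = n\<close>.\<close>

lemma limit_step:
  assumes q: "0 \<le> q" "q \<le> 1"
    and h: "\<And>y. branching_solution q (z y) (h y)"
    and lim: "\<And>x. ((\<lambda>t. h (x * exp (- a * t)) t) \<longlongrightarrow> \<phi> x) at_top"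
    and r: "0 \<le> r"
  shows "((\<lambda>s. exp (- s) *\<^sub>R branching q (\<phi> (x * exp (- a * s)))) has_integral
    (\<phi> x - exp (- r) *\<^sub>R \<phi> (x * exp (- a * r)))) {0..r}"
proof (rule has_integral_dominated_convergence)
  let ?y = "\<lambda>n. x * exp (- a * (real n + r))"
  let ?f = "\<lambda>n s. exp (- s) *\<^sub>R branching q (h (?y n) (real n + r - s))"
  have y: "?y n = (x * exp (- a * s)) * exp (- a * (real n + r - s))" for n s
    by (simp add: mult.assoc flip: exp_add) (simp add: algebra_simps)
  have shift: "filterlim (\<lambda>n. real n + c) at_top sequentially" for c
    by (rule filterlim_tendsto_add_at_top[OF tendsto_const filterlim_real_sequentially, of c, 
        unfolded add.commute[of c]])
  have lim': "(\<lambda>n. h (?y n) (real n + r - s)) \<longlonglongrightarrow> \<phi> (x * exp (- a * s))" for s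
    unfolding y[of _ s]
    using filterlim_compose[OF lim[of "x * exp (- a * s)"] shift[of "r - s"]] by (simp add: add_diff_eq)
  show "(?f n has_integral (h (?y n) (real n + r) - exp (- r) *\<^sub>R h (?y n) (real n))) {0..r}" for n
    using branching_solution_step[OF h, of "real n" r] r by simp
  show "(\<lambda>s. 1 :: real) integrable_on {0..r}" by (rule integrable_const_ivl)
  show "\<forall>s\<in>{0..r}. norm (?f n s) \<le> 1" for n
  proof
    fix s assume s: "s \<in> {0..r}"
    then have "cmod (branching q (h (?y n) (real n + r - s))) \<le> 1"
      by (intro norm_branching_le_1 q branching_solutionD(1)[OF h]) auto
    moreover have "exp (- s) \<le> 1" using s by simp
    ultimately show "norm (?f n s) \<le> 1" by (simp add: mult_le_one)
  qed
  show "\<forall>s\<in>{0..r}. (\<lambda>n. ?f n s) \<longlonglongrightarrow> exp (- s) *\<^sub>R branching q (\<phi> (x * exp (- a * s)))"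
    by (intro ballI tendsto_intros lim')
  show "(\<lambda>n. h (?y n) (real n + r) - exp (- r) *\<^sub>R h (?y n) (real n))
      \<longlonglongrightarrow> \<phi> x - exp (- r) *\<^sub>R \<phi> (x * exp (- a * r))"
    using lim'[of 0] lim'[of r] by (intro tendsto_intros) auto
qed

text \<open>The step equation, read as a function of \<open>r\<close>, shows that \<open>k(r) = \<phi>(x\<^sub>1 e\<^sup>-\<^sup>a\<^sup>r)\<close> is differentiable with
  \<open>k' = k - branching q k\<close>. Near \<open>x \<noteq> 0\<close> the function \<open>\<phi>\<close> is \<open>k\<close> after a change of variable.\<close>

lemma limit_equation_nonzero:
  assumes "0 < a" and cont: "\<And>x. isCont \<phi> x"
    and step: "\<And>x r. 0 \<le> r \<Longrightarrow> ((\<lambda>s. exp (- s) *\<^sub>R branching q (\<phi> (x * exp (- a * s)))) has_integral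
      (\<phi> x - exp (- r) *\<^sub>R \<phi> (x * exp (- a * r)))) {0..r}"
    and "x \<noteq> 0"
  shows "(\<phi> has_vector_derivative (1 / (a * x)) *\<^sub>R (branching q (\<phi> x) - \<phi> x)) (at x)"
proof -
  \<comment> \<open>With this starting point, \<open>x\<close> is reached at \<open>r = 1\<close>, in the interior of the range of \<open>r\<close>.\<close>
  define x1 where "x1 = x * exp a"
  define k where "k r = \<phi> (x1 * exp (- a * r))" for r
  let ?I = "\<lambda>r. integral {0..r} (\<lambda>s. exp (- s) *\<^sub>R branching q (k s))"
  have x1: "x1 * exp (- a) = x" by (simp add: x1_def mult.assoc flip: exp_add)
  have "x1 \<noteq> 0" using \<open>x \<noteq> 0\<close> by (simp add: x1_def)
  have c: "continuous_on {0..2} (\<lambda>s. exp (- s) *\<^sub>R branching q (k s))"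
    unfolding k_def
    by (intro continuous_intros continuous_on_compose2[OF continuous_at_imp_continuous_on, of UNIV \<phi>])
       (auto simp: cont)
  have k: "k r = exp r *\<^sub>R (\<phi> x1 - ?I r)" if "0 \<le> r" for r
  proof -
    have "?I r = \<phi> x1 - exp (- r) *\<^sub>R k r"
      unfolding k_def by (rule integral_unique[OF step[OF that]])
    then show ?thesis by (simp flip: exp_add)
  qed
  have I: "(?I has_vector_derivative exp (- 1) *\<^sub>R branching q (k 1)) (at 1)"
    using integral_has_vector_derivative[OF c, of 1] by (simp add: at_within_Icc_at)
  have e: "(exp has_field_derivative exp 1) (at (1 :: real))"
    by (auto intro!: derivative_eq_intros)
  have "((\<lambda>r. exp r *\<^sub>R (\<phi> x1 - ?I r)) has_vector_derivative
      exp 1 *\<^sub>R (0 - exp (- 1) *\<^sub>R branching q (k 1)) + exp 1 *\<^sub>R (\<phi> x1 - ?I 1)) (at 1)"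
    by (intro has_vector_derivative_scaleR[OF e] has_vector_derivative_diff I has_vector_derivative_const)
  also have "exp 1 *\<^sub>R (0 - exp (- 1) *\<^sub>R branching q (k 1)) + exp 1 *\<^sub>R (\<phi> x1 - ?I 1)
      = k 1 - branching q (k 1)"
    using k[of 1] by (simp add: algebra_simps flip: exp_add)
  finally have k': "(k has_vector_derivative (k 1 - branching q (k 1))) (at 1)"
    by (rule has_vector_derivative_transform_within_open[where S="{0<..<2}"]) (auto simp: k)
  define \<rho> where "\<rho> y = - ln (y / x1) / a" for y
  have \<rho>1: "\<rho> x = 1"
    unfolding \<rho>_def x1_def using \<open>x \<noteq> 0\<close> \<open>0 < a\<close> by (simp add: ln_div)
  have "(\<rho> has_field_derivative - (1 / (a * x))) (at x)"
    unfolding \<rho>_def using \<open>x \<noteq> 0\<close> \<open>0 < a\<close>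
    by (auto intro!: derivative_eq_intros simp: x1_def)
  then have "(\<rho> has_vector_derivative - (1 / (a * x))) (at x)"
    by (simp only: has_real_derivative_iff_has_vector_derivative)
  from vector_diff_chain_at[OF this, of k] k' \<rho>1
  have "((k \<circ> \<rho>) has_vector_derivative - (1 / (a * x)) *\<^sub>R (k 1 - branching q (k 1))) (at x)"
    by simp
  then have "((k \<circ> \<rho>) has_vector_derivative (1 / (a * x)) *\<^sub>R (branching q (\<phi> x) - \<phi> x)) (at x)"
    using x1 by (simp add: k_def algebra_simps)
  then show ?thesis
  proof (rule has_vector_derivative_transform_within_open)
    show "open {y. 0 < y / x1}" by (intro open_Collect_less continuous_intros) (use \<open>x1 \<noteq> 0\<close> in auto)
    show "x \<in> {y. 0 < y / x1}" using \<open>x \<noteq> 0\<close> by (simp add: x1_def)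
    show "(k \<circ> \<rho>) y = \<phi> y" if "y \<in> {y. 0 < y / x1}" for y
      using that \<open>x1 \<noteq> 0\<close> \<open>0 < a\<close> by (simp add: k_def \<rho>_def)
  qed
qed


text \<open>In real terms \<open>r = 1 - Re h\<close> and \<open>G = e\<^sup>-\<^sup>a\<^sup>t Im h\<close> satisfy \<open>r' = r (1 - r) + a (Im h)\<^sup>2\<close> and
  \<open>G' = - (1 + a) r G\<close>. Since \<open>r \<ge> 0\<close>, the modulus of \<open>G\<close> decreases from \<open>|sin y| \<le> |y|\<close>. Hence
  \<open>(e\<^sup>-\<^sup>t r)' \<le> a y\<^sup>2 e\<^sup>(\<^sup>2\<^sup>a\<^sup>-\<^sup>1\<^sup>)\<^sup>t\<close>, which integrates to order \<open>y\<^sup>2 e\<^sup>(\<^sup>2\<^sup>a\<^sup>-\<^sup>1\<^sup>)\<^sup>t\<close> because \<open>2 a > 1\<close>. Inserting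
  this bound for \<open>r\<close> into \<open>G'\<close> controls \<open>G - sin y\<close>. For \<open>y = x e\<^sup>-\<^sup>a\<^sup>t\<close> both bounds are independent of \<open>t\<close>,
  the second one after multiplication by \<open>e\<^sup>a\<^sup>t\<close>.\<close>

lemma branching_solution_bounds:
  fixes h :: "real \<Rightarrow> complex" and a y :: real
  defines "C \<equiv> 1/2 + a / (2 * a - 1)"
  assumes a: "1/2 < a" "a \<le> 1" and h: "branching_solution ((1 + a) / 2) (iexp y) h" and "0 \<le> t"
  shows "1 - Re (h t) \<le> C * y^2 * exp (2 * a * t)"
    and "\<bar>Im (h t) * exp (- a * t) - sin y\<bar> \<le> (1 + a) * C / (2 * a) * \<bar>y\<bar>^3 * exp (2 * a * t)"
proof -
  define r where "r s = 1 - Re (h s)" for s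
  define G where "G s = Im (h s) * exp (- a * s)" for s
  have r0: "r 0 = 1 - cos y" and G0: "G 0 = sin y"
    using branching_solution_0[OF h] by (simp_all add: r_def G_def Re_exp Im_exp)
  have r_nonneg: "0 \<le> r s" if "0 \<le> s" for s
    using abs_Re_le_cmod[of "h s"] branching_solutionD(1)[OF h that] by (simp add: r_def)
  have cont: "continuous_on {0..s} r" "continuous_on {0..s} G" for s
    unfolding r_def G_def by (intro continuous_intros branching_solution_continuous_on[OF h])+
  have h': "(h has_vector_derivative (branching ((1 + a) / 2) (h s) - h s)) (at s)" if "0 < s" for s
    using branching_solution_has_vector_derivative[OF h, of s "s + 1"] that
    by (simp add: at_within_Icc_at)
  have Re_b: "Re (branching ((1 + a) / 2) w) = (Re w)^2 - a * (Im w)^2" for w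
    unfolding Re_branching by (simp add: field_simps)
  have Im_b: "Im (branching ((1 + a) / 2) w) = (1 + a) * Re w * Im w" for w
    unfolding Im_branching by simp
  have Re': "((\<lambda>s. Re (h s)) has_field_derivative
      ((Re (h s))^2 - a * (Im (h s))^2 - Re (h s))) (at s)" if "0 < s" for s
    using bounded_linear.has_vector_derivative[OF bounded_linear_Re h'[OF that]]
    by (simp add: has_real_derivative_iff_has_vector_derivative Re_b)
  have Im': "((\<lambda>s. Im (h s)) has_field_derivative
      ((1 + a) * Re (h s) * Im (h s) - Im (h s))) (at s)" if "0 < s" for s
    using bounded_linear.has_vector_derivative[OF bounded_linear_Im h'[OF that]]
    by (simp add: has_real_derivative_iff_has_vector_derivative Im_b)
  have r': "(r has_field_derivative (r s * (1 - r s) + a * (Im (h s))^2)) (at s)" if "0 < s" for s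
    using DERIV_diff[OF DERIV_const Re'[OF that], of 1] unfolding r_def
    by (simp add: power2_eq_square algebra_simps)
  have G': "(G has_field_derivative - ((1 + a) * r s * G s)) (at s)" if "0 < s" for s
  proof -
    have "((\<lambda>s. exp (- a * s)) has_field_derivative - a * exp (- a * s)) (at s)"
      by (auto intro!: derivative_eq_intros)
    from DERIV_mult[OF Im'[OF that] this] show ?thesis
      unfolding G_def r_def by (simp add: algebra_simps)
  qed
  have Im_eq: "Im (h s) = G s * exp (a * s)" for s
    by (simp add: G_def flip: exp_add)
  have G_sq: "(G s)^2 \<le> y^2" if "0 \<le> s" for s
  proof -
    have "(G s)^2 \<le> (G 0)^2"
    proof (rule DERIV_nonpos_imp_decreasing_open[OF that])
      show "\<exists>D. ((\<lambda>s. (G s)^2) has_field_derivative D) (at u) \<and> D \<le> 0" if "0 < u" "u < s" for u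
      proof (intro exI conjI)
        show "((\<lambda>s. (G s)^2) has_field_derivative (- (2 * (1 + a) * r u * (G u)^2))) (at u)"
          using that by (auto intro!: derivative_eq_intros G' simp: power2_eq_square algebra_simps)
        show "- (2 * (1 + a) * r u * (G u)^2) \<le> 0"
          using a r_nonneg[of u] that by simp
      qed
      show "continuous_on {0..s} (\<lambda>s. (G s)^2)" by (intro continuous_intros cont)
    qed
    also have "\<dots> \<le> y^2"
      using abs_sin_x_le_abs_x[of y] unfolding G0 by (simp add: abs_le_square_iff)
    finally show ?thesis .
  qed
  have r_le: "r s \<le> C * y^2 * exp (2 * a * s)" if "0 \<le> s" for s
  proof -
    let ?A = "a * y^2 / (2 * a - 1)"
    let ?F = "\<lambda>s. ?A * exp ((2 * a - 1) * s) - r s * exp (- s)"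
    have "?F 0 \<le> ?F s"
    proof (rule DERIV_nonneg_imp_increasing_open[OF that])
      show "\<exists>D. (?F has_field_derivative D) (at u) \<and> 0 \<le> D" if u: "0 < u" "u < s" for u
      proof (intro exI conjI)
        let ?D = "a * y^2 * exp ((2 * a - 1) * u)
          - ((r u * (1 - r u) + a * (Im (h u))^2) * exp (- u) - r u * exp (- u))"
        show "(?F has_field_derivative ?D) (at u)"
        proof (rule DERIV_diff)
          show "((\<lambda>s. ?A * exp ((2 * a - 1) * s)) has_field_derivative
              a * y^2 * exp ((2 * a - 1) * u)) (at u)"
            using a by (auto intro!: derivative_eq_intros)
          have "((\<lambda>s. exp (- s)) has_field_derivative - exp (- u)) (at u)"
            by (auto intro!: derivative_eq_intros)
          from DERIV_mult[OF r'[OF u(1)] this]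
          show "((\<lambda>s. r s * exp (- s)) has_field_derivative
              (r u * (1 - r u) + a * (Im (h u))^2) * exp (- u) - r u * exp (- u)) (at u)"
            by (simp add: algebra_simps)
        qed
        have "(Im (h u))^2 * exp (- u) = (G u)^2 * exp ((2 * a - 1) * u)"
          unfolding Im_eq power_mult_distrib
          by (simp add: mult.assoc power2_eq_square flip: exp_add) (simp add: algebra_simps)
        then have "?D = a * (y^2 - (G u)^2) * exp ((2 * a - 1) * u) + (r u)^2 * exp (- u)"
          by (simp add: algebra_simps power2_eq_square)
        also have "\<dots> \<ge> 0" using a G_sq[of u] u by simp
        finally show "0 \<le> ?D" .
      qed
      show "continuous_on {0..s} ?F" by (intro continuous_intros cont)
    qed
    then have "r s * exp (- s) \<le> (1 - cos y) + ?A * exp ((2 * a - 1) * s) - ?A"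
      by (simp add: r0)
    also have "\<dots> \<le> y^2 / 2 * exp ((2 * a - 1) * s) + ?A * exp ((2 * a - 1) * s)"
    proof -
      have "1 - cos y = 2 * (sin (y / 2))^2" using cos_double_sin[of "y / 2"] by simp
      also have "\<dots> \<le> 2 * (y / 2)^2"
        using abs_sin_x_le_abs_x[of "y / 2"] by (simp only: abs_le_square_iff)
      also have "\<dots> = y^2 / 2" by (simp add: power2_eq_square)
      also have "y^2 / 2 \<le> y^2 / 2 * exp ((2 * a - 1) * s)" using a that by (simp add: mult_le_cancel_left1)
      finally have "1 - cos y \<le> y^2 / 2 * exp ((2 * a - 1) * s)" .
      moreover have "0 \<le> ?A" using a by simp
      ultimately show ?thesis by linarith
    qed
    also have "\<dots> = C * y^2 * exp ((2 * a - 1) * s)" by (simp add: C_def field_simps)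
    finally have le: "r s * exp (- s) \<le> C * y^2 * exp ((2 * a - 1) * s)" .
    have "r s = r s * exp (- s) * exp s" by (simp add: mult.assoc flip: exp_add)
    also have "\<dots> \<le> C * y^2 * exp ((2 * a - 1) * s) * exp s"
      using le by (rule mult_right_mono) simp
    also have "\<dots> = C * y^2 * exp (2 * a * s)"
      by (simp add: mult.assoc flip: exp_add) (simp add: algebra_simps)
    finally show ?thesis .
  qed
  show "1 - Re (h t) \<le> C * y^2 * exp (2 * a * t)" using r_le[OF \<open>0 \<le> t\<close>] by (simp add: r_def)
  have "C \<ge> 0" using a by (simp add: C_def)
  let ?K = "(1 + a) * C / (2 * a) * \<bar>y\<bar>^3"
  have bound: "\<bar>(1 + a) * r s * G s\<bar> \<le> (1 + a) * C * \<bar>y\<bar>^3 * exp (2 * a * s)" if "0 \<le> s" for s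
  proof -
    have "\<bar>G s\<bar> \<le> \<bar>y\<bar>" using G_sq[OF that] by (simp add: abs_le_square_iff)
    then have "\<bar>r s\<bar> * \<bar>G s\<bar> \<le> (C * y^2 * exp (2 * a * s)) * \<bar>y\<bar>"
      using r_le[OF that] r_nonneg[OF that] by (intro mult_mono) auto
    then have le: "(1 + a) * (\<bar>r s\<bar> * \<bar>G s\<bar>) \<le> (1 + a) * ((C * y^2 * exp (2 * a * s)) * \<bar>y\<bar>)"
      using a by (intro mult_left_mono) auto
    have y3: "\<bar>y\<bar>^3 = y^2 * \<bar>y\<bar>" by (simp add: power3_eq_cube power2_eq_square)
    have "\<bar>(1 + a) * r s * G s\<bar> = (1 + a) * (\<bar>r s\<bar> * \<bar>G s\<bar>)"
      using a by (simp add: abs_mult mult.assoc)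
    also note le
    also have "(1 + a) * ((C * y^2 * exp (2 * a * s)) * \<bar>y\<bar>) = (1 + a) * C * \<bar>y\<bar>^3 * exp (2 * a * s)"
      unfolding y3 by (simp only: mult_ac)
    finally show ?thesis .
  qed
  have "G t - G 0 \<le> ?K * exp (2 * a * t) - ?K * exp (2 * a * 0)"
    and "G 0 - G t \<le> ?K * exp (2 * a * t) - ?K * exp (2 * a * 0)"
  proof -
    have K': "((\<lambda>s. ?K * exp (2 * a * s)) has_field_derivative
        ((1 + a) * C * \<bar>y\<bar>^3 * exp (2 * a * u))) (at u)" for u
      using a by (auto intro!: derivative_eq_intros)
    have "?K * exp (2 * a * 0) - G 0 \<le> ?K * exp (2 * a * t) - G t"
    proof (rule DERIV_nonneg_imp_increasing_open[OF \<open>0 \<le> t\<close>])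
      show "\<exists>D. ((\<lambda>s. ?K * exp (2 * a * s) - G s) has_field_derivative D) (at u) \<and> 0 \<le> D"
        if "0 < u" "u < t" for u
      proof (intro exI conjI)
        show "((\<lambda>s. ?K * exp (2 * a * s) - G s) has_field_derivative
            ((1 + a) * C * \<bar>y\<bar>^3 * exp (2 * a * u) - - ((1 + a) * r u * G u))) (at u)"
          using that by (intro DERIV_diff[OF K' G'])
        show "0 \<le> (1 + a) * C * \<bar>y\<bar>^3 * exp (2 * a * u) - - ((1 + a) * r u * G u)"
          using bound[of u] that unfolding abs_le_iff by linarith
      qed
    qed (intro continuous_intros cont)
    moreover have "?K * exp (2 * a * 0) + G 0 \<le> ?K * exp (2 * a * t) + G t"
    proof (rule DERIV_nonneg_imp_increasing_open[OF \<open>0 \<le> t\<close>])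
      show "\<exists>D. ((\<lambda>s. ?K * exp (2 * a * s) + G s) has_field_derivative D) (at u) \<and> 0 \<le> D"
        if "0 < u" "u < t" for u
      proof (intro exI conjI)
        show "((\<lambda>s. ?K * exp (2 * a * s) + G s) has_field_derivative
            ((1 + a) * C * \<bar>y\<bar>^3 * exp (2 * a * u) + - ((1 + a) * r u * G u))) (at u)"
          using that by (intro DERIV_add[OF K' G'])
        show "0 \<le> (1 + a) * C * \<bar>y\<bar>^3 * exp (2 * a * u) + - ((1 + a) * r u * G u)"
          using bound[of u] that unfolding abs_le_iff by linarith
      qed
    qed (intro continuous_intros cont)
    ultimately show "G t - G 0 \<le> ?K * exp (2 * a * t) - ?K * exp (2 * a * 0)"
      and "G 0 - G t \<le> ?K * exp (2 * a * t) - ?K * exp (2 * a * 0)" by linarith+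
  qed
  moreover have "0 \<le> ?K" using a \<open>C \<ge> 0\<close> by simp
  ultimately have "\<bar>G t - G 0\<bar> \<le> ?K * exp (2 * a * t)" by (simp add: abs_le_iff)
  then show "\<bar>Im (h t) * exp (- a * t) - sin y\<bar> \<le> ?K * exp (2 * a * t)"
    by (simp add: G0) (simp add: G_def)
qed

lemma has_real_derivative_at_0_quadratic:
  fixes F :: "real \<Rightarrow> real"
  assumes "\<And>x. \<bar>x\<bar> < 1 \<Longrightarrow> \<bar>F x - F 0 - D * x\<bar> \<le> B * x^2"
  shows "(F has_field_derivative D) (at 0)"
  unfolding has_field_derivative_iff
proof (rule LIM_zero_cancel, rule Lim_null_comparison)
  show "\<forall>\<^sub>F x in at 0. norm ((F x - F 0) / (x - 0) - D) \<le> B * \<bar>x\<bar>"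
    unfolding eventually_at
  proof (intro exI[of _ 1] conjI ballI impI)
    fix x :: real assume x: "x \<noteq> 0 \<and> dist x 0 < 1"
    then have "x \<noteq> 0" by simp
    then have "norm ((F x - F 0) / (x - 0) - D) = \<bar>F x - F 0 - D * x\<bar> / \<bar>x\<bar>"
      by (simp add: divide_diff_eq_iff mult.commute flip: abs_divide)
    also have "\<dots> \<le> B * x^2 / \<bar>x\<bar>" using assms[of x] x by (intro divide_right_mono) auto
    also have "\<dots> = B * (\<bar>x\<bar> * \<bar>x\<bar>) / \<bar>x\<bar>" by (simp add: power2_eq_square)
    also have "\<dots> = B * \<bar>x\<bar>" using \<open>x \<noteq> 0\<close> by (simp del: abs_mult_self_eq)
    finally show "norm ((F x - F 0) / (x - 0) - D) \<le> B * \<bar>x\<bar>" .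
  qed simp
  show "((\<lambda>x. B * \<bar>x\<bar>) \<longlongrightarrow> 0) (at 0)" by (auto intro!: tendsto_eq_intros)
qed

section \<open>The recursion for the characteristic function\<close>

definition keep_prob :: "nat \<Rightarrow> real \<Rightarrow> real" where
  "keep_prob d p = (real d * p + real d - 1) / (2 * real d - 1)"

lemma sum_directions:
  fixes F :: "int \<Rightarrow> 'b::comm_monoid_add"
  shows "(\<Sum>c\<in>directions d. F c) = (\<Sum>i=1..d. F (int i) + F (- int i))"
proof -
  have "directions d = int ` {1..d} \<union> (\<lambda>i. - int i) ` {1..d}"
  proof (intro set_eqI iffI)
    fix c assume c: "c \<in> directions d"
    show "c \<in> int ` {1..d} \<union> (\<lambda>i. - int i) ` {1..d}"
    proof (cases "0 < c")
      case True
      then show ?thesis using c by (auto simp: directions_def intro!: image_eqI[of _ _ "nat c"])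
    next
      case False
      then show ?thesis using c
        by (intro UnI2 image_eqI[of _ _ "nat (- c)"]) (auto simp: directions_def)
    qed
  qed (auto simp: directions_def)
  also have "(\<Sum>c\<in>\<dots>. F c) = (\<Sum>c\<in>int ` {1..d}. F c) + (\<Sum>c\<in>(\<lambda>i. - int i) ` {1..d}. F c)"
    by (intro sum.union_disjoint) auto
  also have "\<dots> = (\<Sum>i=1..d. F (int i)) + (\<Sum>i=1..d. F (- int i))"
    by (simp add: sum.reindex inj_on_def)
  finally show ?thesis by (simp add: sum.distrib)
qed

text \<open>Among the \<open>2d - 1\<close> directions other than \<open>c\<close>, exactly \<open>d\<close> have the opposite sign. Hence a sum that depends
  on the sign of the new direction only sees the probability \<open>keep_prob d p\<close> of keeping the sign.\<close>

lemma direction_average: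
  fixes z :: complex
  assumes "1 \<le> d" "c \<in> directions d"
  shows "(\<Sum>c'\<in>directions d. of_real (if c' = c then p else (1 - p) / (2 * real d - 1))
      * (if 0 < c' then z else cnj z))
    = (if 0 < c then of_real (keep_prob d p) * z + of_real (1 - keep_prob d p) * cnj z
       else of_real (keep_prob d p) * cnj z + of_real (1 - keep_prob d p) * z)"
proof -
  define r where "r = (1 - p) / (2 * real d - 1)"
  let ?v = "\<lambda>c'::int. if 0 < c' then z else cnj z"
  have "(\<Sum>c'\<in>directions d. of_real (if c' = c then p else r) * ?v c')
      = (\<Sum>c'\<in>directions d. of_real r * ?v c' + (if c' = c then of_real (p - r) * ?v c' else 0))"
    by (intro sum.cong refl) (auto simp: algebra_simps)
  also have "\<dots> = of_real r * (\<Sum>c'\<in>directions d. ?v c') + of_real (p - r) * ?v c"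
    using assms(2) by (simp add: sum.distrib sum_distrib_left sum.delta)
  also have "(\<Sum>c'\<in>directions d. ?v c') = of_nat d * (z + cnj z)"
    by (simp add: sum_directions)
  finally have sum: "(\<Sum>c'\<in>directions d. of_real (if c' = c then p else r) * ?v c')
      = of_real r * (of_nat d * (z + cnj z)) + of_real (p - r) * ?v c" .
  have nz: "2 * real d - 1 \<noteq> 0" using assms(1) by simp
  have r: "r * (2 * real d - 1) = 1 - p" using nz by (simp add: r_def)
  have q: "keep_prob d p = real d * r + (p - r)"
    unfolding keep_prob_def by (rule divide_eq_imp[OF nz]) (use r in algebra)
  have q': "1 - keep_prob d p = real d * r"
    unfolding q using r by algebra
  show ?thesis
    unfolding r_def[symmetric] sum q' unfolding q by (simp add: algebra_simps)
qed

lemma measurable_first_ring: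
  fixes V :: "real \<Rightarrow> complex"
  assumes V: "continuous_on {0..t} V"
  shows "(\<lambda>s. if t < \<bar>s\<bar> then z else V (t - \<bar>s\<bar>)) \<in> borel_measurable borel"
proof -
  have "continuous_on {-t..t} (\<lambda>s. V (t - \<bar>s\<bar>))"
    by (intro continuous_on_compose2[OF V] continuous_intros) auto
  then have "(\<lambda>s. if s \<in> {-t..t} then V (t - \<bar>s\<bar>) else z) \<in> borel_measurable borel"
    by (intro borel_measurable_continuous_on_if) auto
  also have "(\<lambda>s. if s \<in> {-t..t} then V (t - \<bar>s\<bar>) else z) = (\<lambda>s. if t < \<bar>s\<bar> then z else V (t - \<bar>s\<bar>))"
    by (auto simp: fun_eq_iff)
  finally show ?thesis .
qed

text \<open>Either the first ring comes after \<open>t\<close>, with probability \<open>e\<^sup>-\<^sup>t\<close>, or it comes at some \<open>s \<le> t\<close>; substituting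
  \<open>t - s\<close> for \<open>s\<close> brings out the factor \<open>e\<^sup>-\<^sup>t\<close> in the second case too.\<close>

lemma integral_exponential_first_ring:
  fixes V :: "real \<Rightarrow> complex"
  assumes M: "prob_space M" and T: "distributed M lborel T (exponential_density 1)"
    and V: "continuous_on {0..t} V" and "0 \<le> t"
  shows "(\<integral>s. (if t < \<bar>s\<bar> then z else V (t - \<bar>s\<bar>)) \<partial>distr M borel T)
    = exp (- t) *\<^sub>R (z + integral {0..t} (\<lambda>s. exp s *\<^sub>R V s))"
proof -
  interpret prob_space M by (rule M)
  let ?D = "density lborel (exponential_density 1)"
  interpret D: prob_space ?D by (rule prob_space_exponential_density) simp
  have law: "distr M borel T = ?D"
    using distributed_distr_eq_density[OF T] by (simp cong: distr_cong)
  let ?g = "\<lambda>s. indicator {0..t} s *\<^sub>R (exp (- s) *\<^sub>R V (t - s))"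
  have meas: "(\<lambda>s. if t < \<bar>s\<bar> then z else V (t - \<bar>s\<bar>)) \<in> borel_measurable lborel"
    using measurable_first_ring[OF V] by simp
  have g: "integrable lborel ?g"
  proof -
    have "continuous_on {0..t} (\<lambda>s. exp (- s) *\<^sub>R V (t - s))"
      by (intro continuous_intros continuous_on_compose2[OF V]) auto
    then have "set_integrable lborel {0..t} (\<lambda>s. exp (- s) *\<^sub>R V (t - s))"
      by (rule borel_integrable_atLeastAtMost')
    then show ?thesis by (simp only: set_integrable_def)
  qed
  have late: "integrable lborel (\<lambda>s. exponential_density 1 s *\<^sub>R (indicator {t<..} s *\<^sub>R z))"
    and late_eq: "(\<integral>s. exponential_density 1 s *\<^sub>R (indicator {t<..} s *\<^sub>R z) \<partial>lborel) = exp (- t) *\<^sub>R z"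
  proof -
    have "integrable ?D (\<lambda>s. indicator {t<..} s *\<^sub>R z)"
      by (rule D.integrable_const_bound[where B = "norm z"]) (auto simp: indicator_def)
    then show "integrable lborel (\<lambda>s. exponential_density 1 s *\<^sub>R (indicator {t<..} s *\<^sub>R z))"
      by (subst (asm) integrable_density) auto
    have "(\<integral>s. exponential_density 1 s *\<^sub>R (indicator {t<..} s *\<^sub>R z) \<partial>lborel)
        = (\<integral>s. indicator {t<..} s *\<^sub>R z \<partial>?D)"
      by (subst integral_density) auto
    also have "\<dots> = measure ?D {t<..} *\<^sub>R z"
      by (simp add: D.emeasure_eq_measure)
    also have "measure ?D {t<..} = prob {\<omega> \<in> space M. t < T \<omega>}"
      unfolding law[symmetric] using distributed_measurable[OF T]
      by (subst measure_distr) (auto intro!: arg_cong[where f = prob])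
    also have "\<dots> = exp (- t)"
      using exponential_distributedD_gt[OF T \<open>0 \<le> t\<close>] by simp
    finally show "(\<integral>s. exponential_density 1 s *\<^sub>R (indicator {t<..} s *\<^sub>R z) \<partial>lborel) = exp (- t) *\<^sub>R z" .
  qed
  have "(\<integral>s. (if t < \<bar>s\<bar> then z else V (t - \<bar>s\<bar>)) \<partial>distr M borel T)
      = (\<integral>s. exponential_density 1 s *\<^sub>R (if t < \<bar>s\<bar> then z else V (t - \<bar>s\<bar>)) \<partial>lborel)"
    unfolding law using meas by (subst integral_density) auto
  also have "\<dots> = (\<integral>s. exponential_density 1 s *\<^sub>R (indicator {t<..} s *\<^sub>R z) + ?g s \<partial>lborel)"
    using \<open>0 \<le> t\<close> by (intro Bochner_Integration.integral_cong refl)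
      (auto simp: exponential_density_def indicator_def)
  also have "\<dots> = exp (- t) *\<^sub>R z + (\<integral>s. ?g s \<partial>lborel)"
    by (subst Bochner_Integration.integral_add[OF late g]) (simp only: late_eq)
  also have "(\<integral>s. ?g s \<partial>lborel) = (\<integral>s. ?g (t + (- 1) * s) \<partial>lborel)"
    by (subst lborel_integral_real_affine[where c = "-1" and t = t]) simp_all
  also have "\<dots> = (\<integral>s. indicator {0..t} s *\<^sub>R (exp (- t) *\<^sub>R (exp s *\<^sub>R V s)) \<partial>lborel)"
    by (intro Bochner_Integration.integral_cong refl)
       (auto simp: indicator_def simp flip: exp_add)
  also have "\<dots> = integral {0..t} (\<lambda>s. exp (- t) *\<^sub>R (exp s *\<^sub>R V s))"
  proof -
    have "set_integrable lborel {0..t} (\<lambda>s. exp (- t) *\<^sub>R (exp s *\<^sub>R V s))"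
      by (intro borel_integrable_atLeastAtMost' continuous_intros V)
    from set_borel_integral_eq_integral(2)[OF this] show ?thesis
      by (simp add: set_lebesgue_integral_def)
  qed
  also have "\<dots> = exp (- t) *\<^sub>R integral {0..t} (\<lambda>s. exp s *\<^sub>R V s)"
    by (rule integral_cmul)
  finally show ?thesis by (simp add: algebra_simps)
qed

text \<open>Outside \<open>J\<close> the paths of the product space are constantly \<open>undefined\<close>, so no side condition on \<open>i\<close> arises.\<close>

lemma measurable_PiM_coordinate:
  "(\<lambda>y. y i) \<in> borel_measurable (PiM J (\<lambda>_. borel :: real measure))"
proof (cases "i \<in> J")
  case False
  then have "(\<lambda>y. y i) \<in> borel_measurable (PiM J (\<lambda>_. borel :: real measure))
      \<longleftrightarrow> (\<lambda>y. undefined :: real) \<in> borel_measurable (PiM J (\<lambda>_. borel :: real measure))"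
    by (intro measurable_cong) (auto simp: space_PiM PiE_def extensional_def)
  then show ?thesis by simp
qed simp

text \<open>Picard iterates of the integral equation. They are the characteristic functions, at the argument
  \<open>\<theta>\<close>, of the signed counts over the finite label sets.\<close>

primrec char_rec :: "real \<Rightarrow> real \<Rightarrow> nat \<Rightarrow> real \<Rightarrow> complex" where
  "char_rec q \<theta> 0 t = iexp \<theta>"
| "char_rec q \<theta> (Suc n) t =
     exp (- t) *\<^sub>R (iexp \<theta> + integral {0..t} (\<lambda>s. exp s *\<^sub>R branching q (char_rec q \<theta> n s)))"

lemma continuous_on_char_rec: "continuous_on {0..T} (char_rec q \<theta> n)"
proof (induction n)
  case 0
  have "char_rec q \<theta> 0 = (\<lambda>t. iexp \<theta>)" by (simp add: fun_eq_iff)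
  then show ?case by (simp only: continuous_on_const)
next
  case (Suc n)
  have "(\<lambda>s. exp s *\<^sub>R branching q (char_rec q \<theta> n s)) integrable_on {0..T}"
    by (intro integrable_continuous_real continuous_intros Suc.IH)
  then have "continuous_on {0..T} (\<lambda>t. exp (- t) *\<^sub>R (iexp \<theta> + integral {0..t} (\<lambda>s. exp s *\<^sub>R branching q (char_rec q \<theta> n s))))"
    by (intro continuous_intros indefinite_integral_continuous_1)
  then show ?case by simp
qed

context prob_space
begin

lemma AE_choice_in_directions:
  assumes X: "urn_family d p X" and d: "1 \<le> d" and c: "c \<in> directions d"
  shows "AE \<omega> in M. \<lfloor>X (Inr (u, k, c)) \<omega>\<rfloor> \<in> directions d"
proof -
  let ?E = "\<lambda>c'. {\<omega> \<in> space M. \<lfloor>X (Inr (u, k, c)) \<omega>\<rfloor> = c'}"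
  have [measurable]: "X (Inr (u, k, c)) \<in> borel_measurable M" by (rule urn_familyD(4)[OF X])
  have "prob {\<omega> \<in> space M. \<lfloor>X (Inr (u, k, c)) \<omega>\<rfloor> \<in> directions d} = prob (\<Union>c'\<in>directions d. ?E c')"
    by (intro arg_cong[where f = prob]) auto
  also have "\<dots> = (\<Sum>c'\<in>directions d. prob (?E c'))"
    by (intro finite_measure_finite_Union) (auto simp: disjoint_family_on_def)
  also have "\<dots> = (\<Sum>c'\<in>directions d. if c' = c then p else (1 - p) / (2 * real d - 1))"
    by (intro sum.cong refl urn_familyD(3)[OF X c])
  also have "\<dots> = 1"
  proof -
    have "complex_of_real (\<Sum>c'\<in>directions d. if c' = c then p else (1 - p) / (2 * real d - 1)) = 1"
      using direction_average[OF d c, of p 1] by (simp cong: if_cong)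
    then show ?thesis by (simp only: of_real_eq_1_iff)
  qed
  finally show ?thesis by (subst (asm) prob_Collect_eq_1) auto
qed

lemma prob_choice_of:
  assumes X: "urn_family d p X" and d: "1 \<le> d" and c: "c \<in> directions d" "c' \<in> directions d"
  shows "prob {\<omega> \<in> space M. choice_of d (\<lambda>i. X i \<omega>) u k c = c'}
    = (if c' = c then p else (1 - p) / (2 * real d - 1))"
proof -
  have [measurable]: "(\<lambda>\<omega>. choice_of d (\<lambda>i. X i \<omega>) u k c) \<in> measurable M (count_space UNIV)"
    "X (Inr (u, k, c)) \<in> borel_measurable M"
    using urn_familyD(4)[OF X] by (auto intro: measurable_choice_of)
  have "prob {\<omega> \<in> space M. choice_of d (\<lambda>i. X i \<omega>) u k c = c'}
      = prob {\<omega> \<in> space M. \<lfloor>X (Inr (u, k, c)) \<omega>\<rfloor> = c'}"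
    by (intro finite_measure_eq_AE) (use AE_choice_in_directions[OF X d c(1), of u k] c in
        \<open>auto simp: choice_of_def\<close>)
  then show ?thesis using urn_familyD(3)[OF X c] by simp
qed

text \<open>The direction of the added ball, the delayed coordinates and the grafted coordinates are three disjoint
  groups of coordinates. Conditioning on the direction factorises the expectation.\<close>

lemma expectation_after_first_ring:
  fixes \<theta> s :: real
  assumes X: "urn_family d p X" and d: "1 \<le> d" and c: "c \<in> directions d"
  shows "(\<integral>\<omega>. iexp (\<theta> * (net_count d n c s (\<lambda>i. X (delay_coord i) \<omega>)
      + net_count d n (choice_of d (\<lambda>i. X i \<omega>) [] 0 c) s (\<lambda>i. X (graft_coord i) \<omega>))) \<partial>M)
    = (\<integral>\<omega>. iexp (\<theta> * net_count d n c s (\<lambda>i. X (delay_coord i) \<omega>)) \<partial>M)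
      * (\<Sum>c'\<in>directions d. of_real (if c' = c then p else (1 - p) / (2 * real d - 1))
          * (\<integral>\<omega>. iexp (\<theta> * net_count d n c' s (\<lambda>i. X (graft_coord i) \<omega>)) \<partial>M))"
proof -
  \<comment> \<open>The three groups: \<open>K 0\<close> for the direction of the added ball, \<open>K 1\<close> for the urn of the initial ball,
    and \<open>K 2\<close> for the urn of the added ball. \<open>Z c' j\<close> is the factor read from group \<open>j\<close> on the event that the
    added ball has direction \<open>c'\<close>.\<close>
  define K :: "nat \<Rightarrow> coordinate set" where
    "K j = (if j = 0 then {Inr ([], 0, c)}
      else if j = 1 then delay_coord ` coordinates d else graft_coord ` coordinates d)" for j
  define Z :: "int \<Rightarrow> nat \<Rightarrow> (coordinate \<Rightarrow> real) \<Rightarrow> complex" where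
    "Z c' j y = (if j = 0 then of_real (indicator {c'} (choice_of d y [] 0 c))
      else if j = 1 then iexp (\<theta> * net_count d n c s (\<lambda>i. y (delay_coord i)))
      else iexp (\<theta> * net_count d n c' s (\<lambda>i. y (graft_coord i))))" for c' j y
  have Z_meas: "(\<lambda>\<omega>. Z c' j (x \<omega>)) \<in> borel_measurable N"
    if x: "\<And>i. (\<lambda>\<omega>. x \<omega> i) \<in> borel_measurable N" for c' j N and x :: "'b \<Rightarrow> coordinate \<Rightarrow> real"
  proof -
    have "(\<lambda>\<omega>. complex_of_real (indicator {c'} (choice_of d (x \<omega>) [] 0 c))) \<in> borel_measurable N"
      by (rule measurable_compose[OF measurable_choice_of[OF x]]) simp
    moreover have [measurable]:
      "(\<lambda>\<omega>. net_count d n c s (\<lambda>i. x \<omega> (delay_coord i))) \<in> borel_measurable N"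
      "(\<lambda>\<omega>. net_count d n c' s (\<lambda>i. x \<omega> (graft_coord i))) \<in> borel_measurable N"
      by (intro measurable_net_count x borel_measurable_const)+
    ultimately show ?thesis by (cases "j = 0"; cases "j = 1") (simp_all add: Z_def)
  qed
  have Z_bound: "norm (Z c' j y) \<le> 1" for c' j y
    by (simp add: Z_def indicator_def)
  have Z_int: "integrable M (\<lambda>\<omega>. Z c' j (\<lambda>i. X i \<omega>))" for c' j
    by (rule integrable_const_bound[where B = 1]) (auto simp: Z_bound intro!: Z_meas urn_familyD(4)[OF X])
  have Z_local: "Z c' j (restrict (\<lambda>i. X i \<omega>) (K j)) = Z c' j (\<lambda>i. X i \<omega>)" for c' j \<omega>
  proof -
    have "net_count d n b s (\<lambda>i. restrict (\<lambda>i. X i \<omega>) (delay_coord ` coordinates d) (delay_coord i))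
        = net_count d n b s (\<lambda>i. X (delay_coord i) \<omega>)"
      "net_count d n b s (\<lambda>i. restrict (\<lambda>i. X i \<omega>) (graft_coord ` coordinates d) (graft_coord i))
        = net_count d n b s (\<lambda>i. X (graft_coord i) \<omega>)" for b
      by (rule net_count_cong; simp)+
    then show ?thesis by (auto simp: Z_def K_def choice_of_def)
  qed
  have "indep_vars (\<lambda>j. PiM (K j) (\<lambda>_. borel)) (\<lambda>j \<omega>. restrict (\<lambda>i. X i \<omega>) (K j)) {0, 1, 2}"
    using urn_familyD(1)[OF X]
    by (rule indep_vars_restrict) (use c in \<open>auto simp: K_def disjoint_family_on_def
        delay_coord_neq_first[THEN not_sym] graft_coord_neq_first[THEN not_sym]
        delay_coord_neq_graft_coord[THEN not_sym]\<close>)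
  then have "indep_vars (\<lambda>_. borel) (\<lambda>j \<omega>. Z c' j (restrict (\<lambda>i. X i \<omega>) (K j))) {0, 1, 2}" for c'
    by (rule indep_vars_compose2) (intro Z_meas measurable_PiM_coordinate)
  then have ind: "indep_vars (\<lambda>_. borel) (\<lambda>j \<omega>. Z c' j (\<lambda>i. X i \<omega>)) {0, 1, 2}" for c'
    unfolding Z_local .
  let ?D = "\<lambda>\<omega>. choice_of d (\<lambda>i. X i \<omega>) [] 0 c"
  let ?A = "\<lambda>\<omega>. iexp (\<theta> * net_count d n c s (\<lambda>i. X (delay_coord i) \<omega>))"
  let ?B = "\<lambda>c' \<omega>. iexp (\<theta> * net_count d n c' s (\<lambda>i. X (graft_coord i) \<omega>))"
  have prod: "(\<Prod>j\<in>{0, 1, 2}. Z c' j (\<lambda>i. X i \<omega>)) = of_real (indicator {c'} (?D \<omega>)) * ?A \<omega> * ?B c' \<omega>"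
    for c' \<omega>
    by (simp add: Z_def mult.assoc)
  have int: "integrable M (\<lambda>\<omega>. of_real (indicator {c'} (?D \<omega>)) * ?A \<omega> * ?B c' \<omega>)" for c'
    using indep_vars_integrable[OF _ ind[of c'] Z_int] unfolding prod by simp
  have eq: "(\<integral>\<omega>. of_real (indicator {c'} (?D \<omega>)) * ?A \<omega> * ?B c' \<omega> \<partial>M)
      = of_real (if c' = c then p else (1 - p) / (2 * real d - 1))
        * (\<integral>\<omega>. ?A \<omega> \<partial>M) * (\<integral>\<omega>. ?B c' \<omega> \<partial>M)" if c': "c' \<in> directions d" for c'
  proof -
    have "(\<integral>\<omega>. of_real (indicator {c'} (?D \<omega>)) * ?A \<omega> * ?B c' \<omega> \<partial>M)
        = (\<Prod>j\<in>{0, 1, 2}. \<integral>\<omega>. Z c' j (\<lambda>i. X i \<omega>) \<partial>M)"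
      using indep_vars_lebesgue_integral[OF _ ind[of c'] Z_int] unfolding prod by simp
    also have "\<dots> = (\<integral>\<omega>. of_real (indicator {c'} (?D \<omega>)) \<partial>M) * (\<integral>\<omega>. ?A \<omega> \<partial>M) * (\<integral>\<omega>. ?B c' \<omega> \<partial>M)"
      by (simp add: Z_def mult.assoc)
    also have "(\<integral>\<omega>. complex_of_real (indicator {c'} (?D \<omega>)) \<partial>M)
        = of_real (prob {\<omega> \<in> space M. ?D \<omega> = c'})"
    proof -
      have D: "?D \<in> measurable M (count_space UNIV)"
        by (intro measurable_choice_of urn_familyD(4)[OF X])
      have "(\<integral>\<omega>. indicator {c'} (?D \<omega>) \<partial>M) = (\<integral>\<omega>. indicator {\<omega> \<in> space M. ?D \<omega> = c'} \<omega> \<partial>M)"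
        by (intro Bochner_Integration.integral_cong refl) (auto simp: indicator_def)
      also have "\<dots> = prob {\<omega> \<in> space M. ?D \<omega> = c'}" using D by simp
      finally show ?thesis by simp
    qed
    also have "prob {\<omega> \<in> space M. ?D \<omega> = c'} = (if c' = c then p else (1 - p) / (2 * real d - 1))"
      by (rule prob_choice_of[OF X d c c'])
    finally show ?thesis .
  qed
  have "(\<integral>\<omega>. iexp (\<theta> * (net_count d n c s (\<lambda>i. X (delay_coord i) \<omega>)
        + net_count d n (?D \<omega>) s (\<lambda>i. X (graft_coord i) \<omega>))) \<partial>M)
      = (\<integral>\<omega>. (\<Sum>c'\<in>directions d. of_real (indicator {c'} (?D \<omega>)) * ?A \<omega> * ?B c' \<omega>) \<partial>M)"
  proof (intro Bochner_Integration.integral_cong refl)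
    fix \<omega>
    have "(\<Sum>c'\<in>directions d. of_real (indicator {c'} (?D \<omega>)) * ?A \<omega> * ?B c' \<omega>)
        = (\<Sum>c'\<in>directions d. if c' = ?D \<omega> then ?A \<omega> * ?B c' \<omega> else 0)"
      by (intro sum.cong refl) (auto simp: indicator_def)
    also have "\<dots> = ?A \<omega> * ?B (?D \<omega>) \<omega>" using d by (simp add: sum.delta)
    finally show "iexp (\<theta> * (net_count d n c s (\<lambda>i. X (delay_coord i) \<omega>)
        + net_count d n (?D \<omega>) s (\<lambda>i. X (graft_coord i) \<omega>)))
        = (\<Sum>c'\<in>directions d. of_real (indicator {c'} (?D \<omega>)) * ?A \<omega> * ?B c' \<omega>)"
      by (simp add: distrib_left exp_add)
  qed
  also have "\<dots> = (\<Sum>c'\<in>directions d. (\<integral>\<omega>. of_real (indicator {c'} (?D \<omega>)) * ?A \<omega> * ?B c' \<omega> \<partial>M))"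
    by (intro Bochner_Integration.integral_sum int)
  also have "\<dots> = (\<integral>\<omega>. ?A \<omega> \<partial>M) * (\<Sum>c'\<in>directions d.
      of_real (if c' = c then p else (1 - p) / (2 * real d - 1)) * (\<integral>\<omega>. ?B c' \<omega> \<partial>M))"
    unfolding sum_distrib_left by (intro sum.cong refl) (subst eq, assumption, simp only: mult_ac)
  finally show ?thesis .
qed

text \<open>By induction on the number of splittings, for all urn families simultaneously: conditionally on the first
  ring at \<open>s \<le> t\<close>, the two parts are urns observed at time \<open>t - s\<close>. The conjugation symmetry between positive
  and negative starting directions is part of the same induction.\<close>

lemma char_net_count:
  assumes d: "1 \<le> d"
  shows "urn_family d p X \<Longrightarrow> c \<in> directions d \<Longrightarrow> 0 \<le> t \<Longrightarrow>
    (\<integral>\<omega>. iexp (\<theta> * net_count d n c t (\<lambda>i. X i \<omega>)) \<partial>M)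
      = (if 0 < c then char_rec (keep_prob d p) \<theta> n t else cnj (char_rec (keep_prob d p) \<theta> n t))"
proof (induction n arbitrary: X c t)
  case 0
  then show ?case
    by (auto simp: net_count_0 prob_space directions_def exp_cnj sgn_if)
next
  case (Suc n)
  note X = Suc.prems(1) and c = Suc.prems(2) and t = Suc.prems(3)
  let ?q = "keep_prob d p"
  let ?r = "Inl ([], 0) :: coordinate"
  let ?z = "iexp (\<theta> * real_of_int (sgn c))"
  define V where "V u = (if 0 < c then branching ?q (char_rec ?q \<theta> n u)
    else cnj (branching ?q (char_rec ?q \<theta> n u)))" for u
  define J where "J = coordinates d - {?r}"
  \<comment> \<open>The integrand as a function of the first ring \<open>s\<close> and of all remaining coordinates \<open>y\<close>.\<close>
  define \<Phi> where "\<Phi> = (\<lambda>(s, y). if t < \<bar>s\<bar> then ?z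
    else iexp (\<theta> * (net_count d n c (t - \<bar>s\<bar>) (\<lambda>i. y (delay_coord i))
      + net_count d n (choice_of d y [] 0 c) (t - \<bar>s\<bar>) (\<lambda>i. y (graft_coord i)))))"
  define Y where "Y \<omega> = restrict (\<lambda>i. X i \<omega>) J" for \<omega>
  have coord: "(\<lambda>y. y i) \<in> borel_measurable (PiM J (\<lambda>_. borel :: real measure))" for i
    by (rule measurable_PiM_coordinate)
  have \<Phi>_meas: "\<Phi> \<in> borel_measurable (borel \<Otimes>\<^sub>M PiM J (\<lambda>_. borel))"
  proof -
    let ?N = "borel \<Otimes>\<^sub>M PiM J (\<lambda>_. borel :: real measure)"
    have y: "(\<lambda>z. snd z i) \<in> borel_measurable ?N" for i
      by (rule measurable_compose[OF measurable_snd coord])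
    have [measurable]: "(\<lambda>z. net_count d n b (t - \<bar>fst z\<bar>) (\<lambda>i. snd z (f i))) \<in> borel_measurable ?N" for b f
      by (rule measurable_net_count[OF y]) measurable
    have [measurable]: "(\<lambda>z. net_count d n (choice_of d (snd z) [] 0 c) (t - \<bar>fst z\<bar>)
        (\<lambda>i. snd z (graft_coord i))) \<in> borel_measurable ?N"
      by (rule measurable_compose_countable[OF _ measurable_choice_of[OF y]]) measurable
    show ?thesis unfolding \<Phi>_def case_prod_beta by measurable
  qed
  have \<Phi>_eq: "\<Phi> (s, Y \<omega>) = (if t < \<bar>s\<bar> then ?z
      else iexp (\<theta> * (net_count d n c (t - \<bar>s\<bar>) (\<lambda>i. X (delay_coord i) \<omega>)
        + net_count d n (choice_of d (\<lambda>i. X i \<omega>) [] 0 c) (t - \<bar>s\<bar>) (\<lambda>i. X (graft_coord i) \<omega>))))" for s \<omega>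
  proof -
    have "net_count d n b (t - \<bar>s\<bar>) (\<lambda>i. Y \<omega> (delay_coord i))
        = net_count d n b (t - \<bar>s\<bar>) (\<lambda>i. X (delay_coord i) \<omega>)"
      "net_count d n b (t - \<bar>s\<bar>) (\<lambda>i. Y \<omega> (graft_coord i))
        = net_count d n b (t - \<bar>s\<bar>) (\<lambda>i. X (graft_coord i) \<omega>)" for b
      by (rule net_count_cong; simp add: Y_def J_def)+
    moreover have "choice_of d (Y \<omega>) [] 0 c = choice_of d (\<lambda>i. X i \<omega>) [] 0 c"
      using c by (simp add: choice_of_def Y_def J_def)
    ultimately show ?thesis by (simp add: \<Phi>_def)
  qed
  let ?S = "PiM {?r} (\<lambda>_. borel :: real measure)"
  define T where "T \<omega> = restrict (\<lambda>i. X i \<omega>) {?r}" for \<omega>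
  have ind: "indep_var ?S T (PiM J (\<lambda>_. borel)) Y"
    unfolding T_def Y_def using urn_familyD(1)[OF X] by (rule indep_var_restrict) (auto simp: J_def)
  have T: "T \<in> measurable M ?S" by (rule indep_var_rv1[OF ind])
  have \<Phi>'_meas: "(\<lambda>(f, y). \<Phi> (f ?r, y)) \<in> borel_measurable (?S \<Otimes>\<^sub>M PiM J (\<lambda>_. borel))"
    using \<Phi>_meas by measurable
  have T_first: "T \<omega> ?r = X ?r \<omega>" for \<omega> by (simp add: T_def)
  have \<Phi>_bound: "norm (\<Phi> z) \<le> 1" for z by (simp add: \<Phi>_def case_prod_beta)
  have V_cont: "continuous_on {0..t} V"
    unfolding V_def by (cases "0 < c") (auto intro!: continuous_intros continuous_on_char_rec)
  have "(\<integral>\<omega>. iexp (\<theta> * net_count d (Suc n) c t (\<lambda>i. X i \<omega>)) \<partial>M) = (\<integral>\<omega>. \<Phi> (X ?r \<omega>, Y \<omega>) \<partial>M)"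
    unfolding \<Phi>_eq net_count_Suc[OF t] by (intro Bochner_Integration.integral_cong refl) simp
  also have "\<dots> = (\<integral>f. (\<integral>\<omega>. \<Phi> (f ?r, Y \<omega>) \<partial>M) \<partial>distr M ?S T)"
    using expectation_indep_pair[OF ind \<Phi>'_meas, of 1] \<Phi>_bound by (simp add: T_first case_prod_beta)
  also have "\<dots> = (\<integral>f. (if t < \<bar>f ?r\<bar> then ?z else V (t - \<bar>f ?r\<bar>)) \<partial>distr M ?S T)"
  proof (intro Bochner_Integration.integral_cong refl)
    fix f :: "coordinate \<Rightarrow> real"
    define s where "s = f ?r"
    have "(\<integral>\<omega>. \<Phi> (s, Y \<omega>) \<partial>M) = (if t < \<bar>s\<bar> then ?z else V (t - \<bar>s\<bar>))"
    proof (cases "t < \<bar>s\<bar>")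
      case True
      then show ?thesis by (simp add: \<Phi>_eq prob_space)
    next
      case False
      then have u: "0 \<le> t - \<bar>s\<bar>" by simp
      let ?h = "char_rec ?q \<theta> n (t - \<bar>s\<bar>)"
      have "(\<integral>\<omega>. \<Phi> (s, Y \<omega>) \<partial>M) = (if 0 < c then ?h else cnj ?h)
          * (\<Sum>c'\<in>directions d. of_real (if c' = c then p else (1 - p) / (2 * real d - 1))
              * (if 0 < c' then ?h else cnj ?h))"
        unfolding \<Phi>_eq if_not_P[OF False] expectation_after_first_ring[OF X d c]
          Suc.IH[OF urn_family_delay[OF X] c u]
        by (intro arg_cong2[where f = "(*)"] sum.cong refl Suc.IH[OF urn_family_graft[OF X] _ u])
      also have "\<dots> = V (t - \<bar>s\<bar>)"
        unfolding direction_average[OF d c] V_def branching_eq by (simp add: algebra_simps)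
      finally show ?thesis using False by simp
    qed
    then show "(\<integral>\<omega>. \<Phi> (f ?r, Y \<omega>) \<partial>M) = (if t < \<bar>f ?r\<bar> then ?z else V (t - \<bar>f ?r\<bar>))"
      by (simp only: s_def)
  qed
  also have "\<dots> = (\<integral>s. (if t < \<bar>s\<bar> then ?z else V (t - \<bar>s\<bar>)) \<partial>distr M borel (X ?r))"
    using T urn_familyD(4)[OF X] measurable_first_ring[OF V_cont]
    by (subst (1 2) integral_distr) (auto simp: T_first cong: if_cong intro: measurable_compose[OF measurable_PiM_coordinate])
  also have "\<dots> = exp (- t) *\<^sub>R (?z + integral {0..t} (\<lambda>s. exp s *\<^sub>R V s))"
    by (rule integral_exponential_first_ring[OF prob_space_axioms urn_familyD(2)[OF X] V_cont t])
  also have "\<dots> = (if 0 < c then char_rec ?q \<theta> (Suc n) t else cnj (char_rec ?q \<theta> (Suc n) t))"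
  proof (cases "0 < c")
    case True
    then show ?thesis by (simp add: V_def)
  next
    case False
    then have "c < 0" using c by (simp add: directions_def)
    then have "?z = cnj (iexp \<theta>)" by (simp add: exp_cnj)
    moreover have "integral {0..t} (\<lambda>s. exp s *\<^sub>R V s)
        = cnj (integral {0..t} (\<lambda>s. exp s *\<^sub>R branching ?q (char_rec ?q \<theta> n s)))"
      using False by (simp add: V_def integral_cnj)
    ultimately show ?thesis using False by simp
  qed
  finally show ?case .
qed

end

section \<open>Finitely many balls at any time\<close>

text \<open>The clocks whose durations add up to the birth time of \<open>u\<close>. They are pairwise different, so the Laplace
  transform of a birth time is a power of that of a single clock.\<close>

primrec rings :: "nat list \<Rightarrow> (nat list \<times> nat) set" where
  "rings [] = {}"
| "rings (k # u) = rings u \<union> {u} \<times> {..k}"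

lemma rings_length: "(v, j) \<in> rings u \<Longrightarrow> length v < length u"
  by (induction u) auto

lemma finite_rings [simp]: "finite (rings u)"
  by (induction u) auto

lemma rings_disjoint: "rings u \<inter> {u} \<times> {..k} = {}"
  using rings_length by blast

lemma card_rings_Cons: "card (rings (k # u)) = card (rings u) + Suc k"
  by (simp add: card_Un_disjoint rings_disjoint card_cartesian_product)

lemma birth_time_rings: "birth_time \<tau> u = (\<Sum>(v, j)\<in>rings u. \<tau> v j)"
proof (induction u)
  case (Cons k u)
  have "(\<Sum>(v, j)\<in>{u} \<times> {..k}. \<tau> v j) = (\<Sum>j\<le>k. \<tau> u j)"
    by (simp flip: sum.cartesian_product)
  then show ?case using Cons.IH by (simp add: sum.union_disjoint rings_disjoint)
qed simp

lemma card_rings_delay: "u \<noteq> [] \<Longrightarrow> card (rings (delay u)) = Suc (card (rings u))"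
proof (induction u)
  case (Cons k u)
  then show ?case by (cases "u = []") (simp_all add: card_rings_Cons del: rings.simps(2))
qed simp

lemma card_rings_graft: "card (rings (graft u)) = Suc (card (rings u))"
proof (induction u)
  case Nil
  show ?case by (simp add: card_cartesian_product)
next
  case (Cons k u)
  then show ?case by (simp only: append_Cons card_rings_Cons)
qed

text \<open>With \<open>s\<^sub>n\<close> for the sum, splitting off the root gives \<open>s\<^sub>n\<^sub>+\<^sub>1 = 1 + (s\<^sub>n - 1) / 3 + s\<^sub>n / 3\<close>, a recursion with
  fixed point \<open>2\<close>. The base \<open>1/3\<close> is \<open>E e\<^sup>-\<^sup>2\<^sup>T\<close> for a clock \<open>T\<close>; with \<open>E e\<^sup>-\<^sup>T = 1/2\<close> the sums would grow
  without bound.\<close>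

lemma sum_labels_rings_le: "(\<Sum>u\<in>labels n. (1 / 3 :: real) ^ card (rings u)) \<le> 2"
proof (induction n)
  case (Suc n)
  let ?F = "\<lambda>u. (1 / 3 :: real) ^ card (rings u)"
  let ?s = "\<Sum>u\<in>labels n. ?F u"
  have "(\<Sum>u\<in>labels n. ?F (delay u)) = ?F [] + (\<Sum>u\<in>labels n - {[]}. ?F (delay u))"
    by (subst sum.remove[of _ "[]"]) auto
  also have "(\<Sum>u\<in>labels n - {[]}. ?F (delay u)) = (\<Sum>u\<in>labels n - {[]}. ?F u / 3)"
    by (intro sum.cong refl) (simp add: card_rings_delay)
  also have "\<dots> = (?s - 1) / 3"
    by (subst (2) sum.remove[of _ "[]"]) (auto simp: sum_divide_distrib)
  finally have "(\<Sum>u\<in>labels (Suc n). ?F u) = 1 + (?s - 1) / 3 + ?s / 3"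
    unfolding sum_labels_Suc by (simp add: card_rings_graft sum_divide_distrib)
  then show ?case using Suc.IH by (simp add: field_simps)
qed simp

lemma signed_count_eventually:
  assumes "finite {u. birth_time \<tau> u \<le> t}"
  shows "\<forall>\<^sub>F n in sequentially. signed_count n c t \<tau> \<delta>
    = (\<Sum>u | birth_time \<tau> u \<le> t. of_int (sgn (direction_from \<delta> c u)))"
proof -
  obtain N where N: "{u. birth_time \<tau> u \<le> t} \<subseteq> labels N"
    using finite_subset_labels[OF assms] by blast
  show ?thesis
  proof (rule eventually_sequentiallyI)
    fix n assume "N \<le> n"
    then have "{u. birth_time \<tau> u \<le> t} \<subseteq> labels n" using N labels_mono[of N n] by blast
    then show "signed_count n c t \<tau> \<delta>
        = (\<Sum>u | birth_time \<tau> u \<le> t. of_int (sgn (direction_from \<delta> c u)))"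
      unfolding signed_count_def by (intro sum.mono_neutral_cong_right) auto
  qed
qed

lemma finite_alive:
  fixes B :: real
  assumes "\<And>n. (\<Sum>u\<in>labels n. exp (- 2 * birth_time \<tau> u)) \<le> B"
  shows "finite {u. birth_time \<tau> u \<le> t}"
proof (rule ccontr)
  assume inf: "infinite {u. birth_time \<tau> u \<le> t}"
  obtain m :: nat where m: "B * exp (2 * t) < real m" using reals_Archimedean2 by blast
  obtain F where F: "F \<subseteq> {u. birth_time \<tau> u \<le> t}" "finite F" "card F = m"
    using infinite_arbitrarily_large[OF inf] by blast
  obtain n where n: "F \<subseteq> labels n" using finite_subset_labels[OF F(2)] by blast
  have "real m * exp (- 2 * t) = (\<Sum>u\<in>F. exp (- 2 * t))" using F(3) by simp
  also have "\<dots> \<le> (\<Sum>u\<in>F. exp (- 2 * birth_time \<tau> u))" using F(1) by (intro sum_mono) auto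
  also have "\<dots> \<le> (\<Sum>u\<in>labels n. exp (- 2 * birth_time \<tau> u))" using n by (intro sum_mono2) auto
  also have "\<dots> \<le> B" by (rule assms)
  finally have "real m * exp (- 2 * t) * exp (2 * t) \<le> B * exp (2 * t)" by (rule mult_right_mono) simp
  then show False using m by (simp add: mult.assoc flip: exp_add)
qed

context prob_space
begin

lemma nn_integral_exponential_clock:
  assumes "distributed M lborel T (exponential_density 1)"
  shows "(\<integral>\<^sup>+\<omega>. ennreal (exp (- 2 * \<bar>T \<omega>\<bar>)) \<partial>M) = ennreal (1 / 3)"
proof -
  interpret E: prob_space "density lborel (exponential_density 3)"
    by (rule prob_space_exponential_density) simp
  have "(\<integral>\<^sup>+\<omega>. ennreal (exp (- 2 * \<bar>T \<omega>\<bar>)) \<partial>M)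
      = (\<integral>\<^sup>+s. ennreal (exponential_density 1 s) * ennreal (exp (- 2 * \<bar>s\<bar>)) \<partial>lborel)"
    using distributed_nn_integral[OF assms, of "\<lambda>s. ennreal (exp (- 2 * \<bar>s\<bar>))"] by simp
  also have "\<dots> = (\<integral>\<^sup>+s. ennreal (1 / 3) * ennreal (exponential_density 3 s) \<partial>lborel)"
    by (intro nn_integral_cong)
       (auto simp: exponential_density_def simp flip: ennreal_mult' exp_add)
  also have "\<dots> = ennreal (1 / 3) * (\<integral>\<^sup>+s. ennreal (exponential_density 3 s) \<partial>lborel)"
    by (rule nn_integral_cmult) simp
  also have "(\<integral>\<^sup>+s. ennreal (exponential_density 3 s) \<partial>lborel) = 1"
    using E.emeasure_space_1 by (simp add: emeasure_density)
  finally show ?thesis by simp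
qed

lemma nn_integral_birth_time:
  assumes X: "urn_family d p X"
  shows "(\<integral>\<^sup>+\<omega>. ennreal (exp (- 2 * birth_time (clock_of (\<lambda>i. X i \<omega>)) u)) \<partial>M)
    = ennreal ((1 / 3) ^ card (rings u))"
proof -
  have "indep_vars (\<lambda>_. borel) (\<lambda>r. X (Inl r)) (rings u)"
    using urn_familyD(1)[OF X] by (rule indep_vars_reindex) auto
  then have ind: "indep_vars (\<lambda>_. borel) (\<lambda>r \<omega>. ennreal (exp (- 2 * \<bar>X (Inl r) \<omega>\<bar>))) (rings u)"
    by (rule indep_vars_compose2) measurable
  have "(\<integral>\<^sup>+\<omega>. ennreal (exp (- 2 * birth_time (clock_of (\<lambda>i. X i \<omega>)) u)) \<partial>M)
      = (\<integral>\<^sup>+\<omega>. (\<Prod>r\<in>rings u. ennreal (exp (- 2 * \<bar>X (Inl r) \<omega>\<bar>))) \<partial>M)"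
  proof (intro nn_integral_cong)
    fix \<omega>
    have "exp (- 2 * birth_time (clock_of (\<lambda>i. X i \<omega>)) u) = (\<Prod>r\<in>rings u. exp (- 2 * \<bar>X (Inl r) \<omega>\<bar>))"
      unfolding birth_time_rings sum_distrib_left
      by (subst exp_sum) (auto simp: clock_of_def intro!: prod.cong)
    then show "ennreal (exp (- 2 * birth_time (clock_of (\<lambda>i. X i \<omega>)) u))
        = (\<Prod>r\<in>rings u. ennreal (exp (- 2 * \<bar>X (Inl r) \<omega>\<bar>)))"
      by (simp add: prod_ennreal)
  qed
  also have "\<dots> = (\<Prod>r\<in>rings u. \<integral>\<^sup>+\<omega>. ennreal (exp (- 2 * \<bar>X (Inl r) \<omega>\<bar>)) \<partial>M)"
    by (rule indep_vars_nn_integral[OF _ ind]) auto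
  also have "\<dots> = (\<Prod>r\<in>rings u. ennreal (1 / 3))"
    by (intro prod.cong refl, rule nn_integral_exponential_clock)
       (metis urn_familyD(2)[OF X] surj_pair)
  finally show ?thesis by (simp add: ennreal_power)
qed

text \<open>No explosion: by monotone convergence the sum of \<open>e\<^sup>-\<^sup>2\<^sup>b\<close> over the birth times \<open>b\<close> of all balls has expectation
  at most \<open>2\<close>, hence is almost surely finite, while each ball born before \<open>t\<close> contributes at least \<open>e\<^sup>-\<^sup>2\<^sup>t\<close>.\<close>

lemma AE_finite_alive:
  assumes X: "urn_family d p X"
  shows "AE \<omega> in M. \<forall>t. finite {u. birth_time (clock_of (\<lambda>i. X i \<omega>)) u \<le> t}"
proof -
  let ?\<tau> = "\<lambda>\<omega>. clock_of (\<lambda>i. X i \<omega>)"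
  let ?S = "\<lambda>n \<omega>. \<Sum>u\<in>labels n. exp (- 2 * birth_time (?\<tau> \<omega>) u)"
  have [measurable]: "(\<lambda>\<omega>. birth_time (?\<tau> \<omega>) u) \<in> borel_measurable M" for u
    by (rule measurable_birth_time) (rule urn_familyD(4)[OF X])
  have "incseq (\<lambda>n \<omega>. ennreal (?S n \<omega>))"
    using labels_mono by (intro incseq_SucI le_funI ennreal_leI sum_mono2) (auto simp del: labels.simps)
  then have "(\<integral>\<^sup>+\<omega>. (SUP n. ennreal (?S n \<omega>)) \<partial>M) = (SUP n. \<integral>\<^sup>+\<omega>. ennreal (?S n \<omega>) \<partial>M)"
    by (intro nn_integral_monotone_convergence_SUP) auto
  also have "\<dots> \<le> 2"
  proof (rule SUP_least)
    fix n
    have "(\<integral>\<^sup>+\<omega>. ennreal (?S n \<omega>) \<partial>M)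
        = (\<Sum>u\<in>labels n. \<integral>\<^sup>+\<omega>. ennreal (exp (- 2 * birth_time (?\<tau> \<omega>) u)) \<partial>M)"
      by (subst nn_integral_sum[symmetric]) (auto simp: sum_ennreal)
    also have "\<dots> = ennreal (\<Sum>u\<in>labels n. (1 / 3) ^ card (rings u))"
      unfolding nn_integral_birth_time[OF X] by (rule sum_ennreal) simp
    also have "\<dots> \<le> ennreal 2" by (intro ennreal_leI sum_labels_rings_le)
    finally show "(\<integral>\<^sup>+\<omega>. ennreal (?S n \<omega>) \<partial>M) \<le> 2" by simp
  qed
  finally have "(\<integral>\<^sup>+\<omega>. (SUP n. ennreal (?S n \<omega>)) \<partial>M) \<noteq> \<infinity>" by (auto simp: top_unique)
  then have "AE \<omega> in M. (SUP n. ennreal (?S n \<omega>)) \<noteq> \<infinity>"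
    by (intro nn_integral_PInf_AE) measurable
  then show ?thesis
  proof eventually_elim
    case (elim \<omega>)
    then obtain B where B: "(SUP n. ennreal (?S n \<omega>)) = ennreal B" "0 \<le> B"
      by (cases "SUP n. ennreal (?S n \<omega>)") auto
    have "ennreal (?S n \<omega>) \<le> ennreal B" for n
      unfolding B(1)[symmetric] by (rule SUP_upper) simp
    then have "?S n \<omega> \<le> B" for n using B(2) by simp
    then show ?case using finite_alive by blast
  qed
qed

end

section \<open>The urn as a family of independent coordinates\<close>

text \<open>Choices for parents outside the set of directions carry no assumption, not even measurability, and are
  replaced by \<open>0\<close>.\<close>

definition urn_coordinates ::
  "nat \<Rightarrow> (nat list \<Rightarrow> nat \<Rightarrow> 'a \<Rightarrow> real) \<Rightarrow> (nat list \<Rightarrow> nat \<Rightarrow> int \<Rightarrow> 'a \<Rightarrow> int) \<Rightarrow>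
    coordinate \<Rightarrow> 'a \<Rightarrow> real" where
  "urn_coordinates d clock choice = case_sum (\<lambda>(u, k). clock u k)
     (\<lambda>(u, k, c) \<omega>. if c \<in> directions d then real_of_int (choice u k c \<omega>) else 0)"

context direction_urn
begin

abbreviation "coords \<equiv> urn_coordinates d clock choice"

definition sign_sum :: "real \<Rightarrow> 'a \<Rightarrow> real" where
  "sign_sum t \<omega> = (\<Sum>i=1..d. real (urn_count clock choice t (int i) \<omega>)
     - real (urn_count clock choice t (- int i) \<omega>))"

lemma urn_family_coords: "urn_family d p coords"
proof -
  let ?X = "case_sum (\<lambda>(u, k). clock u k) (\<lambda>(u, k, c) \<omega>. real_of_int (choice u k c \<omega>))"
  have eq: "coords i = ?X i" if "i \<in> coordinates d" for i
    using that by (auto simp: urn_coordinates_def fun_eq_iff split: sum.split)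
  have ind: "indep_vars (\<lambda>_. borel) coords (coordinates d)"
    using indep unfolding coordinates_def[symmetric]
    by (subst indep_vars_cong[OF refl eq refl]) simp_all
  have meas: "coords i \<in> borel_measurable M" for i
  proof (cases "i \<in> coordinates d")
    case True
    then show ?thesis using ind by (auto simp: indep_vars_def2)
  next
    case False
    then have "coords i = (\<lambda>\<omega>. 0)"
      by (cases i) (auto simp: urn_coordinates_def fun_eq_iff)
    then show ?thesis by simp
  qed
  show ?thesis
    unfolding urn_family_def using ind meas clock_law choice_law
    by (simp add: urn_coordinates_def)
qed

lemma AE_clock_of: "AE \<omega> in M. clock_of (\<lambda>i. coords i \<omega>) = (\<lambda>u k. clock u k \<omega>)"
proof -
  have "AE \<omega> in M. 0 \<le> clock u k \<omega>" for u k
  proof -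
    have "AE s in distr M lborel (clock u k). 0 \<le> s"
      unfolding distributed_distr_eq_density[OF clock_law]
      by (subst AE_density) (auto simp: exponential_density_def)
    then show ?thesis
      by (rule AE_distrD[OF distributed_measurable[OF clock_law]])
  qed
  then have "AE \<omega> in M. \<forall>u k. 0 \<le> clock u k \<omega>" by (simp add: AE_all_countable)
  then show ?thesis
    by eventually_elim (simp add: clock_of_def urn_coordinates_def fun_eq_iff)
qed

lemma AE_choice_of:
  assumes "1 \<le> d"
  shows "AE \<omega> in M. \<forall>u k. \<forall>c\<in>directions d. choice u k c \<omega> \<in> directions d"
proof -
  have "AE \<omega> in M. choice u k c \<omega> \<in> directions d" if "c \<in> directions d" for u k c
    using AE_choice_in_directions[OF urn_family_coords assms that, of u k] that
    by (simp add: urn_coordinates_def)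
  then have "AE \<omega> in M. c \<in> directions d \<longrightarrow> choice u k c \<omega> \<in> directions d" for u k c
    by (cases "c \<in> directions d") auto
  then have "AE \<omega> in M. \<forall>u k c. c \<in> directions d \<longrightarrow> choice u k c \<omega> \<in> directions d"
    by (simp add: AE_all_countable)
  then show ?thesis by eventually_elim blast
qed

text \<open>At time \<open>t\<close> only finitely many balls are present, so the counts over the finite label sets stabilise at the
  sum of all signs. Grouping this sum by direction gives the urn counts.\<close>

lemma AE_net_count:
  assumes d: "1 \<le> d"
  shows "AE \<omega> in M. \<forall>t. \<forall>\<^sub>F n in sequentially. net_count d n 1 t (\<lambda>i. coords i \<omega>) = sign_sum t \<omega>"
  using AE_finite_alive[OF urn_family_coords] AE_clock_of AE_choice_of[OF d]
proof eventually_elim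
  case (elim \<omega>)
  let ?\<tau> = "\<lambda>u k. clock u k \<omega>" and ?\<delta> = "\<lambda>u k c. choice u k c \<omega>"
  let ?\<delta>' = "choice_of d (\<lambda>i. coords i \<omega>)"
  have dir: "direction_from ?\<delta>' 1 u = direction ?\<delta> u \<and> direction ?\<delta> u \<in> directions d" for u
    by (induction u) (use d elim(3) in \<open>auto simp: choice_of_def urn_coordinates_def\<close>)
  show ?case
  proof
    fix t
    let ?A = "{u. birth_time ?\<tau> u \<le> t}"
    have fin: "finite ?A" using elim(1,2) by simp
    have "(\<Sum>u\<in>?A. real_of_int (sgn (direction ?\<delta> u)))
        = (\<Sum>c\<in>directions d. \<Sum>u | u \<in> ?A \<and> direction ?\<delta> u = c. real_of_int (sgn (direction ?\<delta> u)))"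
      using fin dir by (intro sum.group[symmetric]) auto
    also have "\<dots> = (\<Sum>c\<in>directions d. real_of_int (sgn c) * real (urn_count clock choice t c \<omega>))"
      by (intro sum.cong refl) (simp add: urn_count_def)
    also have "\<dots> = sign_sum t \<omega>"
      unfolding sum_directions sign_sum_def by (intro sum.cong refl) simp
    finally have "(\<Sum>u\<in>?A. real_of_int (sgn (direction ?\<delta> u))) = sign_sum t \<omega>" .
    then show "\<forall>\<^sub>F n in sequentially. net_count d n 1 t (\<lambda>i. coords i \<omega>) = sign_sum t \<omega>"
      using signed_count_eventually[OF fin, of 1 ?\<delta>'] dir elim(2) by (simp add: net_count_def)
  qed
qed

end

section \<open>Passing to the limit\<close>

text \<open>The integral equation survives the limit \<open>n \<rightarrow> \<infinity>\<close> by dominated convergence, since the iterates are bounded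
  by \<open>1\<close>.\<close>

lemma branching_solution_limit:
  assumes q: "0 \<le> q" "q \<le> 1"
    and bound: "\<And>n t. 0 \<le> t \<Longrightarrow> cmod (char_rec q \<theta> n t) \<le> 1"
    and lim: "\<And>t. 0 \<le> t \<Longrightarrow> (\<lambda>n. char_rec q \<theta> n t) \<longlonglongrightarrow> h t"
  shows "branching_solution q (iexp \<theta>) h"
  unfolding branching_solution_def
proof (intro conjI allI impI)
  fix t :: real assume t: "0 \<le> t"
  show "cmod (h t) \<le> 1"
    using bound[OF t] by (intro LIMSEQ_le_const2[OF tendsto_norm[OF lim[OF t]]]) auto
  let ?f = "\<lambda>n s. exp s *\<^sub>R branching q (char_rec q \<theta> n s)"
  let ?g = "\<lambda>s. exp s *\<^sub>R branching q (h s)"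
  have f: "?f n integrable_on {0..t}" for n
    by (intro integrable_continuous_real continuous_intros continuous_on_char_rec)
  have e: "(exp :: real \<Rightarrow> real) integrable_on {0..t}"
    by (intro integrable_continuous_real continuous_intros)
  have le: "norm (?f n s) \<le> exp s" if "s \<in> {0..t}" for n s
    using norm_branching_le_1[OF q bound, of s n] that by simp
  have conv: "(\<lambda>n. ?f n s) \<longlonglongrightarrow> ?g s" if "s \<in> {0..t}" for s
    using that by (intro tendsto_intros lim) simp
  show "?g integrable_on {0..t}" by (rule dominated_convergence(1)[OF f e le conv])
  have "(\<lambda>n. char_rec q \<theta> (Suc n) t) \<longlonglongrightarrow> exp (- t) *\<^sub>R (iexp \<theta> + integral {0..t} ?g)"
    unfolding char_rec.simps
    by (intro tendsto_intros dominated_convergence(2)[OF f e le conv])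
  then show "h t = exp (- t) *\<^sub>R (iexp \<theta> + integral {0..t} ?g)"
    by (rule LIMSEQ_unique[OF LIMSEQ_Suc[OF lim[OF t]]])
qed

lemma tendsto_scaled_sin:
  fixes a x :: real
  assumes "0 < a"
  shows "((\<lambda>t. exp (a * t) * sin (x * exp (- a * t))) \<longlongrightarrow> x) at_top"
proof (cases "x = 0")
  case False
  have "((\<lambda>y::real. sin y / y) \<longlongrightarrow> 1) (at 0)"
    using DERIV_sin[of "0::real"] by (simp add: has_field_derivative_iff)
  moreover have "filterlim (\<lambda>t. x * exp (- a * t)) (at 0) at_top"
  proof (rule filterlim_atI)
    have "filterlim (\<lambda>t. - a * t) at_bot at_top"
      using assms by (intro filterlim_tendsto_neg_mult_at_bot[OF tendsto_const _ filterlim_ident]) simp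
    then have "((\<lambda>t. exp (- a * t)) \<longlongrightarrow> 0) at_top" by (rule filterlim_compose[OF exp_at_bot])
    then show "((\<lambda>t. x * exp (- a * t)) \<longlongrightarrow> 0) at_top" by (rule tendsto_mult_right_zero)
  qed (use False in simp)
  ultimately have "((\<lambda>t. sin (x * exp (- a * t)) / (x * exp (- a * t))) \<longlongrightarrow> 1) at_top"
    by (rule filterlim_compose)
  from tendsto_mult[OF tendsto_const[of x] this] show ?thesis
    using False by (simp add: exp_minus field_simps)
qed simp

text \<open>For \<open>y = x e\<^sup>-\<^sup>a\<^sup>t\<close> the estimates for \<open>h\<^sub>y(t)\<close> become \<open>1 - Re h = O(x\<^sup>2)\<close> and
  \<open>Im h = e\<^sup>a\<^sup>t sin(x e\<^sup>-\<^sup>a\<^sup>t) + O(|x|\<^sup>3)\<close> uniformly in \<open>t\<close>; let \<open>t \<rightarrow> \<infinity>\<close>.\<close>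

lemma limit_derivative_at_0:
  fixes a :: real
  assumes a: "1/2 < a" "a \<le> 1"
    and h: "\<And>y. branching_solution ((1 + a) / 2) (iexp y) (h y)"
    and lim: "\<And>x. ((\<lambda>t. h (x * exp (- a * t)) t) \<longlongrightarrow> \<phi> x) at_top"
  shows "\<phi> 0 = 1" and "(\<phi> has_vector_derivative \<i>) (at 0)"
proof -
  define C where "C = 1/2 + a / (2 * a - 1)"
  define K where "K = (1 + a) * C / (2 * a)"
  have "0 \<le> C" using a by (simp add: C_def)
  then have "0 \<le> K" using a by (simp add: K_def)
  have Re_bound: "\<bar>Re (\<phi> x) - 1\<bar> \<le> C * x^2" for x
  proof -
    have *: "\<forall>\<^sub>F t in at_top. \<bar>Re (h (x * exp (- a * t)) t) - 1\<bar> \<le> C * x^2"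
      using eventually_ge_at_top[of 0]
    proof eventually_elim
      case (elim t)
      have "Re (h (x * exp (- a * t)) t) \<le> 1"
        using complex_Re_le_cmod[of "h (x * exp (- a * t)) t"] branching_solutionD(1)[OF h elim]
        by (rule order_trans)
      moreover have "1 - Re (h (x * exp (- a * t)) t) \<le> C * (x * exp (- a * t))^2 * exp (2 * a * t)"
        unfolding C_def by (rule branching_solution_bounds(1)[OF a h elim])
      moreover have "C * (x * exp (- a * t))^2 * exp (2 * a * t) = C * x^2"
        by (simp add: power_mult_distrib mult.assoc flip: exp_double exp_add)
      ultimately show ?case by linarith
    qed
    have "((\<lambda>t. \<bar>Re (h (x * exp (- a * t)) t) - 1\<bar>) \<longlongrightarrow> \<bar>Re (\<phi> x) - 1\<bar>) at_top"
      by (intro tendsto_intros lim)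
    from tendsto_upperbound[OF this *] show ?thesis by simp
  qed
  have Im_bound: "\<bar>Im (\<phi> x) - x\<bar> \<le> K * \<bar>x\<bar>^3" for x
  proof -
    have *: "\<forall>\<^sub>F t in at_top. \<bar>Im (h (x * exp (- a * t)) t) - exp (a * t) * sin (x * exp (- a * t))\<bar> \<le> K * \<bar>x\<bar>^3"
      using eventually_ge_at_top[of 0]
    proof eventually_elim
      case (elim t)
      let ?y = "x * exp (- a * t)"
      have "\<bar>Im (h ?y t) * exp (- a * t) - sin ?y\<bar> * exp (a * t) \<le> (K * \<bar>?y\<bar>^3 * exp (2 * a * t)) * exp (a * t)"
        unfolding K_def C_def by (intro mult_right_mono branching_solution_bounds(2)[OF a h elim]) simp
      moreover have "\<bar>Im (h ?y t) * exp (- a * t) - sin ?y\<bar> * exp (a * t)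
          = \<bar>Im (h ?y t) - exp (a * t) * sin ?y\<bar>"
      proof -
        have "\<bar>Im (h ?y t) * exp (- a * t) - sin ?y\<bar> * exp (a * t)
            = \<bar>(Im (h ?y t) * exp (- a * t) - sin ?y) * exp (a * t)\<bar>"
          by (simp add: abs_mult)
        also have "(Im (h ?y t) * exp (- a * t) - sin ?y) * exp (a * t)
            = Im (h ?y t) - exp (a * t) * sin ?y"
          by (simp add: left_diff_distrib mult.assoc flip: exp_add)
        finally show ?thesis .
      qed
      moreover have "(K * \<bar>?y\<bar>^3 * exp (2 * a * t)) * exp (a * t) = K * \<bar>x\<bar>^3"
      proof -
        have "\<bar>?y\<bar>^3 = \<bar>x\<bar>^3 * exp (- (3 * a * t))"
          by (simp add: abs_mult power_mult_distrib flip: exp_of_nat_mult)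
        then show ?thesis by (simp add: mult.assoc flip: exp_add)
      qed
      ultimately show ?case by linarith
    qed
    have "((\<lambda>t. \<bar>Im (h (x * exp (- a * t)) t) - exp (a * t) * sin (x * exp (- a * t))\<bar>)
        \<longlongrightarrow> \<bar>Im (\<phi> x) - x\<bar>) at_top"
      using a by (intro tendsto_intros lim tendsto_scaled_sin) simp
    from tendsto_upperbound[OF this *] show ?thesis by simp
  qed
  show \<phi>0: "\<phi> 0 = 1"
    using Re_bound[of 0] Im_bound[of 0] by (simp add: complex_eq_iff)
  have "((\<lambda>x. Re (\<phi> x)) has_field_derivative 0) (at 0)"
    using Re_bound \<phi>0 by (intro has_real_derivative_at_0_quadratic[where B = C]) simp
  moreover have "((\<lambda>x. Im (\<phi> x)) has_field_derivative 1) (at 0)"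
  proof (rule has_real_derivative_at_0_quadratic[where B = K])
    fix x :: real assume "\<bar>x\<bar> < 1"
    then have "\<bar>x\<bar>^3 \<le> \<bar>x\<bar>^2" by (intro power_decreasing) auto
    then have "K * \<bar>x\<bar>^3 \<le> K * x^2" using \<open>0 \<le> K\<close> by (intro mult_left_mono) auto
    then show "\<bar>Im (\<phi> x) - Im (\<phi> 0) - 1 * x\<bar> \<le> K * x^2"
      using Im_bound[of x] \<phi>0 by simp
  qed
  ultimately show "(\<phi> has_vector_derivative \<i>) (at 0)"
    by (simp add: has_vector_derivative_complex_iff has_real_derivative_iff_has_vector_derivative)
qed

context direction_urn
begin

text \<open>A version of \<open>sign_sum t\<close> that is measurable by construction. The cardinalities in \<open>sign_sum t\<close> are
  limits of the signed counts only almost surely.\<close>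

definition limit_count :: "real \<Rightarrow> 'a \<Rightarrow> real" where
  "limit_count t \<omega> = lim (\<lambda>n. net_count d n 1 t (\<lambda>i. coords i \<omega>))"

lemma measurable_limit_count [measurable]: "limit_count t \<in> borel_measurable M"
  unfolding limit_count_def
  by (intro borel_measurable_lim_metric measurable_net_count urn_familyD(4)[OF urn_family_coords]) simp

lemma AE_limit_count:
  assumes "1 \<le> d"
  shows "AE \<omega> in M. \<forall>t. (\<lambda>n. net_count d n 1 t (\<lambda>i. coords i \<omega>)) \<longlonglongrightarrow> sign_sum t \<omega>
    \<and> limit_count t \<omega> = sign_sum t \<omega>"
  using AE_net_count[OF assms]
proof eventually_elim
  case (elim \<omega>)
  show ?case
  proof (intro allI conjI)
    fix t
    show *: "(\<lambda>n. net_count d n 1 t (\<lambda>i. coords i \<omega>)) \<longlonglongrightarrow> sign_sum t \<omega>"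
      using elim by (intro tendsto_eventually) auto
    show "limit_count t \<omega> = sign_sum t \<omega>" unfolding limit_count_def by (rule limI[OF *])
  qed
qed

definition urn_char :: "real \<Rightarrow> real \<Rightarrow> complex" where
  "urn_char y t = (\<integral>\<omega>. iexp (y * limit_count t \<omega>) \<partial>M)"

lemma branching_solution_urn_char:
  assumes d: "1 \<le> d" and q: "0 \<le> keep_prob d p" "keep_prob d p \<le> 1"
  shows "branching_solution (keep_prob d p) (iexp y) (urn_char y)"
proof (rule branching_solution_limit[OF q])
  have eq: "char_rec (keep_prob d p) y n t = (\<integral>\<omega>. iexp (y * net_count d n 1 t (\<lambda>i. coords i \<omega>)) \<partial>M)"
    if "0 \<le> t" for n t
    using char_net_count[OF d urn_family_coords one_in_directions[OF d] that] by simp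
  have [measurable]: "(\<lambda>\<omega>. net_count d n 1 t (\<lambda>i. coords i \<omega>)) \<in> borel_measurable M" for n t
    by (intro measurable_net_count urn_familyD(4)[OF urn_family_coords]) simp
  show "cmod (char_rec (keep_prob d p) y n t) \<le> 1" if "0 \<le> t" for n t
  proof -
    have "cmod (char_rec (keep_prob d p) y n t)
        \<le> (\<integral>\<omega>. cmod (iexp (y * net_count d n 1 t (\<lambda>i. coords i \<omega>))) \<partial>M)"
      unfolding eq[OF that] by (rule integral_norm_bound)
    then show ?thesis by (simp add: prob_space)
  qed
  show "(\<lambda>n. char_rec (keep_prob d p) y n t) \<longlonglongrightarrow> urn_char y t" if "0 \<le> t" for t
    unfolding eq[OF that] urn_char_def
  proof (rule integral_dominated_convergence[where w = "\<lambda>_. 1"])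
    show "AE \<omega> in M. (\<lambda>n. iexp (y * net_count d n 1 t (\<lambda>i. coords i \<omega>))) \<longlonglongrightarrow> iexp (y * limit_count t \<omega>)"
      using AE_limit_count[OF d] by eventually_elim (auto intro!: tendsto_intros)
  qed (auto simp: norm_exp_i_times)
qed

lemma tendsto_urn_char:
  assumes d: "1 \<le> d" and w: "w \<in> borel_measurable M"
    and lim: "AE \<omega> in M. ((\<lambda>t. sign_sum t \<omega> / exp (a * t)) \<longlongrightarrow> w \<omega>) at_top"
  shows "((\<lambda>t. urn_char (x * exp (- a * t)) t) \<longlongrightarrow> char (distr M borel w) x) at_top"
proof -
  have "char (distr M borel w) x = (\<integral>\<omega>. iexp (x * w \<omega>) \<partial>M)"
    unfolding char_def using w by (subst integral_distr) auto
  moreover have "((\<lambda>t. \<integral>\<omega>. iexp (x * exp (- a * t) * limit_count t \<omega>) \<partial>M)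
      \<longlongrightarrow> (\<integral>\<omega>. iexp (x * w \<omega>) \<partial>M)) at_top"
  proof (rule integral_dominated_convergence_at_top[where w = "\<lambda>_. 1"])
    show "AE \<omega> in M. ((\<lambda>t. iexp (x * exp (- a * t) * limit_count t \<omega>)) \<longlongrightarrow> iexp (x * w \<omega>)) at_top"
      using AE_limit_count[OF d] lim
    proof eventually_elim
      case (elim \<omega>)
      have "x * exp (- a * t) * limit_count t \<omega> = x * (sign_sum t \<omega> / exp (a * t))" for t
        using elim(1) by (simp add: exp_minus divide_inverse mult_ac)
      then show ?case using elim(2) by (simp only:) (intro tendsto_intros)
    qed
  qed (use w in \<open>auto simp: norm_exp_i_times\<close>)
  ultimately show ?thesis by (simp only: urn_char_def)
qed

theorem urn_limit_equation:
  fixes a :: real and w :: "'a \<Rightarrow> real"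
  defines "\<phi> \<equiv> char (distr M borel w)"
  assumes d: "1 \<le> d" and a: "1/2 < a" "a \<le> 1" and q: "keep_prob d p = (1 + a) / 2"
    and w: "w \<in> borel_measurable M"
    and lim: "AE \<omega> in M. ((\<lambda>t. sign_sum t \<omega> / exp (a * t)) \<longlongrightarrow> w \<omega>) at_top"
  obtains \<phi>' where "\<And>x. (\<phi> has_vector_derivative \<phi>' x) (at x)"
    and "\<And>x. \<phi> x + of_real (a * x) * \<phi>' x = branching (keep_prob d p) (\<phi> x)"
    and "\<phi> 0 = 1" and "\<phi>' 0 = \<i>"
proof -
  interpret D: real_distribution "distr M borel w" by (rule real_distribution_distr[OF w])
  have q01: "0 \<le> keep_prob d p" "keep_prob d p \<le> 1" using a by (simp_all add: q)
  have h: "branching_solution (keep_prob d p) (iexp y) (urn_char y)" for y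
    by (rule branching_solution_urn_char[OF d q01])
  have conv: "((\<lambda>t. urn_char (x * exp (- a * t)) t) \<longlongrightarrow> \<phi> x) at_top" for x
    unfolding \<phi>_def by (rule tendsto_urn_char[OF d w lim])
  have step: "((\<lambda>s. exp (- s) *\<^sub>R branching (keep_prob d p) (\<phi> (x * exp (- a * s)))) has_integral
      (\<phi> x - exp (- r) *\<^sub>R \<phi> (x * exp (- a * r)))) {0..r}" if "0 \<le> r" for x r
    by (rule limit_step[OF q01 h conv that])
  have cont: "isCont \<phi> x" for x unfolding \<phi>_def by (rule D.isCont_char)
  have at0: "\<phi> 0 = 1" "(\<phi> has_vector_derivative \<i>) (at 0)"
    using limit_derivative_at_0[OF a h[unfolded q] conv] by blast+
  define \<phi>' where
    "\<phi>' x = (if x = 0 then \<i> else (1 / (a * x)) *\<^sub>R (branching (keep_prob d p) (\<phi> x) - \<phi> x))" for x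
  have nonzero: "(\<phi> has_vector_derivative (1 / (a * x)) *\<^sub>R (branching (keep_prob d p) (\<phi> x) - \<phi> x)) (at x)"
    if "x \<noteq> 0" for x
    using a by (intro limit_equation_nonzero[OF _ cont step that]) simp
  show thesis
  proof
    show "(\<phi> has_vector_derivative \<phi>' x) (at x)" for x
      using at0(2) nonzero[of x] by (cases "x = 0") (simp_all add: \<phi>'_def)
    show "\<phi> x + of_real (a * x) * \<phi>' x = branching (keep_prob d p) (\<phi> x)" for x
    proof (cases "x = 0")
      case True
      then show ?thesis by (simp add: at0(1) branching_def flip: of_real_add)
    next
      case False
      then have "a * x \<noteq> 0" using a by simp
      then have "of_real (a * x) * ((1 / (a * x)) *\<^sub>R z) = z" for z :: complex
        by (simp only: scaleR_conv_of_real mult.assoc[symmetric] of_real_mult[symmetric]) simp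
      then show ?thesis using False by (simp only: \<phi>'_def if_False) simp
    qed
    show "\<phi> 0 = 1" by (rule at0(1))
    show "\<phi>' 0 = \<i>" by (simp add: \<phi>'_def)
  qed
qed

end

text \<open>What remains is the arithmetic of \<open>a\<close>, \<open>q\<close> and the critical value of \<open>p\<close>, and the real and imaginary
  parts of the equation.\<close>

theorem proposition2p2:
  fixes M :: "'a measure" and d :: nat and p a :: real
    and clock :: "nat list \<Rightarrow> nat \<Rightarrow> 'a \<Rightarrow> real"
    and choice :: "nat list \<Rightarrow> nat \<Rightarrow> int \<Rightarrow> 'a \<Rightarrow> int"
    and W :: "nat \<Rightarrow> 'a \<Rightarrow> real" and w :: "'a \<Rightarrow> real"
    and \<phi> :: "real \<Rightarrow> complex" and f g :: "real \<Rightarrow> real"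
  assumes "d \<ge> 1" and "critical_p d < p" and "p \<le> 1"
    and "a = (2 * real d * p - 1) / (2 * real d - 1)"
    and "direction_urn M d p clock choice"
    and "\<And>i. i \<in> {1..d} \<Longrightarrow> W i \<in> borel_measurable M"
    and "AE \<omega> in M. \<forall>i\<in>{1..d}.
      ((\<lambda>t. (real (urn_count clock choice t (int i) \<omega>)
              - real (urn_count clock choice t (- int i) \<omega>)) / exp (a * t))
        \<longlongrightarrow> W i \<omega>) at_top"
    and "w = (\<lambda>\<omega>. \<Sum>i=1..d. W i \<omega>)"
    and "\<phi> = char (distr M borel w)"
    and "f = (\<lambda>x. Re (\<phi> x))" and "g = (\<lambda>x. Im (\<phi> x))"
  shows "(\<forall>x. \<phi> differentiable (at x) \<and>
      \<phi> x + of_real (a * x) * vector_derivative \<phi> (at x) =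
        of_real ((real d * p + real d - 1) / (2 * real d - 1)) * (\<phi> x)^2
        + of_real ((real d - real d * p) / (2 * real d - 1)) * of_real ((cmod (\<phi> x))^2)) \<and>
    (\<forall>x. f differentiable (at x) \<and> g differentiable (at x) \<and>
      f x + a * x * deriv f x = (f x)^2 + (1 - 2 * real d * p) / (2 * real d - 1) * (g x)^2 \<and>
      g x + a * x * deriv g x =
        2 * (real d * p + real d - 1) / (2 * real d - 1) * f x * g x) \<and>
    f 0 = 1 \<and> deriv g 0 = 1"
proof -
  interpret direction_urn M d p clock choice by (rule assms(5))
  let ?q = "keep_prob d p"
  have pos: "0 < 2 * real d - 1" using assms(1) by simp
  have q: "?q = (1 + a) / 2" and q': "1 - ?q = (real d - real d * p) / (2 * real d - 1)"
    and a_eq: "1 - 2 * ?q = (1 - 2 * real d * p) / (2 * real d - 1)"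
    unfolding keep_prob_def assms(4) using pos by (simp_all add: divide_simps) (simp_all add: algebra_simps)
  have a_ge: "1/2 < a"
  proof -
    have "(2 * real d + 1) / (4 * real d) < p" using assms(2) by (simp add: critical_p_def)
    then have "2 * real d + 1 < p * (4 * real d)" using assms(1) by (simp add: pos_divide_less_eq)
    then show ?thesis unfolding assms(4) using pos by (simp add: pos_less_divide_eq field_simps)
  qed
  have a_le: "a \<le> 1"
  proof -
    have "real d * p \<le> real d" using assms(3) by (simp add: mult_left_le)
    then show ?thesis unfolding assms(4) using pos by (simp add: pos_divide_le_eq)
  qed
  have w: "w \<in> borel_measurable M" unfolding assms(8) by (intro borel_measurable_sum assms(6))
  have "AE \<omega> in M. ((\<lambda>t. sign_sum t \<omega> / exp (a * t)) \<longlongrightarrow> w \<omega>) at_top"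
    using assms(7)
  proof eventually_elim
    case (elim \<omega>)
    then show ?case
      unfolding sign_sum_def assms(8) sum_divide_distrib by (intro tendsto_sum) auto
  qed
  from urn_limit_equation[OF assms(1) a_ge a_le q w this, folded assms(9)]
  obtain \<phi>' where D: "\<And>x. (\<phi> has_vector_derivative \<phi>' x) (at x)"
    and eq: "\<And>x. \<phi> x + of_real (a * x) * \<phi>' x = branching ?q (\<phi> x)"
    and zero: "\<phi> 0 = 1" "\<phi>' 0 = \<i>" by blast
  have Df: "(f has_field_derivative Re (\<phi>' x)) (at x)" and Dg: "(g has_field_derivative Im (\<phi>' x)) (at x)" for x
    unfolding assms(10,11) has_real_derivative_iff_has_vector_derivative
    using D[of x] by (simp_all add: has_vector_derivative_complex_iff has_real_derivative_iff_has_vector_derivative)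
  have f_eq: "f x + a * x * Re (\<phi>' x) = (f x)^2 + (1 - 2 * ?q) * (g x)^2" for x
    using arg_cong[OF eq[of x], of Re] by (simp add: assms(10,11) Re_branching)
  have g_eq: "g x + a * x * Im (\<phi>' x) = 2 * ?q * f x * g x" for x
    using arg_cong[OF eq[of x], of Im] by (simp add: assms(10,11) Im_branching)
  have complex_eq: "\<phi> x + of_real (a * x) * vector_derivative \<phi> (at x) =
      of_real ((real d * p + real d - 1) / (2 * real d - 1)) * (\<phi> x)^2
      + of_real ((real d - real d * p) / (2 * real d - 1)) * of_real ((cmod (\<phi> x))^2)" for x
    using eq[of x] unfolding vector_derivative_at[OF D] branching_def q' unfolding keep_prob_def .
  show ?thesis
  proof (intro conjI allI)
    fix x
    show "\<phi> differentiable (at x)" by (rule differentiableI_vector[OF D])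
    show "f differentiable (at x)" "g differentiable (at x)"
      using Df Dg by (auto simp: real_differentiable_def)
    show "f x + a * x * deriv f x = (f x)^2 + (1 - 2 * real d * p) / (2 * real d - 1) * (g x)^2"
      unfolding DERIV_imp_deriv[OF Df] f_eq a_eq ..
    show "g x + a * x * deriv g x = 2 * (real d * p + real d - 1) / (2 * real d - 1) * f x * g x"
      unfolding DERIV_imp_deriv[OF Dg] g_eq by (simp add: keep_prob_def)
  qed (rule complex_eq, simp_all add: DERIV_imp_deriv[OF Dg] zero assms(10))
qed

end
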